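(* Let $\mathcal{U} \subseteq \mathcal{P}$ be a nonempty open set. Then there is a constant $c_1 = c_1(\mathcal{U}) > 0$ such that for every $\delta \in (0, 1/4]$ and for every sequence of estimators $\hat{a}_n : \Omega^n \to \mathbb{R}$, $n \in \mathbb{N}$, one has $$\liminf_{n \to \infty} \sup_{P \in \mathcal{U}} P^n\big[n^{1/3}|\hat{a}_n - a(P)| > T\big] \geq \delta,$$ where $T = T(\mathcal{U}, \delta) := c_1 |\log(11\delta)|^{1/3}$.
   Context: Let $\Omega = [0,1] \times \{\pm 1\}$ with the Borel $\sigma$-field. Let $\tilde{\mathcal{P}}$ be the set of all probability measures $P$ on $\Omega$ having a density $f_P \in C^1([0,1]\times\{\pm 1\})$ with respect to (Lebesgue measure on $[0,1]$) $\otimes$ (counting measure on $\{\pm1\}$). Write $f_P^+ := f_P(\cdot,1)$ and $f_P^- := f_P(\cdot,-1)$. Endow $\tilde{\mathcal{P}}$ with the metric $d(P,Q) := \|f_P - f_Q\|_\infty + \|\partial_1 f_P - \partial_1 f_Q\|_\infty$, where $\partial_1$ is the derivative with respect to the first argument. Let $\mathcal{P} \subseteq \tilde{\mathcal{P}}$ be the set of all $P \in \tilde{\mathcal{P}}$ such that there is a unique point $a(P) \in [0,1]$ with $f_P^+(a(P)) = f_P^-(a(P))$, this point lies in the open interval $(0,1)$, and $(f_P^+)'(a(P)) > (f_P^-)'(a(P))$. $\mathcal{P}$ carries the topology induced by $d$; "open" means open in $\mathcal{P}$. $P^n$ denotes the $n$-fold product measure of $P$ on $\Omega^n$. An estimator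 is a measurable function $\hat a_n:\Omega^n \to \mathbb{R}$. *)

theory Defs
  imports "HOL-Probability.Probability"
begin

definition Omega :: "(real \<times> int) set" where
  "Omega = {0..1} \<times> {-1, 1}"

definition Omega_borel :: "(real \<times> int) measure" where
  "Omega_borel = restrict_space borel Omega"

definition ref_measure :: "(real \<times> int) measure" where
  "ref_measure = restrict_space lborel {0..1} \<Otimes>\<^sub>M count_space {-1, 1}"

text \<open>The derivative is taken within \<open>[0,1]\<close>, hence one-sided at the endpoints.\<close>

definition partial1 :: "(real \<times> int \<Rightarrow> real) \<Rightarrow> real \<times> int \<Rightarrow> real" where
  "partial1 f = (\<lambda>(x, y). vector_derivative (\<lambda>t. f (t, y)) (at x within {0..1}))"

definition C1_Omega :: "(real \<times> int \<Rightarrow> real) \<Rightarrow> bool" where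
  "C1_Omega f \<longleftrightarrow>
     (\<forall>(x, y)\<in>Omega. (\<lambda>t. f (t, y)) differentiable (at x within {0..1})) \<and>
     continuous_on Omega (partial1 f)"

definition is_C1_density :: "(real \<times> int) measure \<Rightarrow> (real \<times> int \<Rightarrow> real) \<Rightarrow> bool" where
  "is_C1_density P f \<longleftrightarrow>
     C1_Omega f \<and> (\<forall>w\<in>Omega. 0 \<le> f w) \<and> P = density ref_measure (\<lambda>w. ennreal (f w))"

definition calP_tilde :: "(real \<times> int) measure set" where
  "calP_tilde =
     {P. prob_space P \<and> sets P = sets Omega_borel \<and> (\<exists>f. is_C1_density P f)}"

text \<open>
  By lemma \<open>is_C1_density_unique\<close> below, the chosen density is determined on \<^const>\<open>Omega\<close>.
  Its values elsewhere are arbitrary and never used.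
\<close>

definition dens :: "(real \<times> int) measure \<Rightarrow> real \<times> int \<Rightarrow> real" where
  "dens P = (SOME f. is_C1_density P f)"

text \<open>
  The value \<open>0\<close> outside \<^const>\<open>calP_tilde\<close> is a convention: the library locale
  \<^locale>\<open>Metric_space\<close> requires non-negativity of the distance off the carrier too.
\<close>

definition dist_P :: "(real \<times> int) measure \<Rightarrow> (real \<times> int) measure \<Rightarrow> real" where
  "dist_P P Q =
     (if P \<in> calP_tilde \<and> Q \<in> calP_tilde
      then (SUP w\<in>Omega. \<bar>dens P w - dens Q w\<bar>)
         + (SUP w\<in>Omega. \<bar>partial1 (dens P) w - partial1 (dens Q) w\<bar>)
      else 0)"

definition crossing :: "(real \<times> int) measure \<Rightarrow> real" where
  "crossing P = (THE x. x \<in> {0..1} \<and> dens P (x, 1) = dens P (x, -1))"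

definition calP :: "(real \<times> int) measure set" where
  "calP =
     {P \<in> calP_tilde.
        (\<exists>!x. x \<in> {0..1} \<and> dens P (x, 1) = dens P (x, -1)) \<and>
        crossing P \<in> {0<..<1} \<and>
        partial1 (dens P) (crossing P, 1) > partial1 (dens P) (crossing P, -1)}"

definition calP_topology :: "(real \<times> int) measure topology" where
  "calP_topology = subtopology (Metric_space.mtopology calP_tilde dist_P) calP"

lemma space_ref_measure: "space ref_measure = Omega"
  by (simp add: ref_measure_def Omega_def space_pair_measure)

lemma space_Omega_borel: "space Omega_borel = Omega"
  by (simp add: Omega_borel_def space_restrict_space)

lemma sets_ref_measure: "sets ref_measure = sets Omega_borel"
proof
  have f: "fst \<in> Omega_borel \<rightarrow>\<^sub>M restrict_space lborel {0..1}"
    unfolding Omega_borel_def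
    by (intro measurable_restrict_space2 measurable_restrict_space1)
       (auto simp: space_restrict_space Omega_def intro!: borel_measurable_continuous_onI continuous_intros)
  have "snd \<in> (borel :: (real \<times> int) measure) \<rightarrow>\<^sub>M borel"
    by (intro borel_measurable_continuous_onI continuous_intros)
  then have "snd \<in> (borel :: (real \<times> int) measure) \<rightarrow>\<^sub>M count_space UNIV"
    using measurable_cong_sets[OF refl sets_borel_eq_count_space] by blast
  then have "snd \<in> Omega_borel \<rightarrow>\<^sub>M count_space UNIV"
    unfolding Omega_borel_def by (rule measurable_restrict_space1)
  then have s: "snd \<in> Omega_borel \<rightarrow>\<^sub>M count_space {-1, 1}"
    by (subst measurable_count_space_eq_countable)
       (auto simp: space_Omega_borel Omega_def measurable_count_space_eq_countable)
  have id1: "(\<lambda>w. w) \<in> Omega_borel \<rightarrow>\<^sub>M ref_measure"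
    unfolding ref_measure_def using measurable_Pair[OF f s] by simp
  show "sets ref_measure \<subseteq> sets Omega_borel"
  proof
    fix A assume A: "A \<in> sets ref_measure"
    then have "A \<subseteq> Omega" using sets.sets_into_space space_ref_measure by blast
    then show "A \<in> sets Omega_borel"
      using measurable_sets[OF id1 A] by (simp add: space_Omega_borel Int_absorb2)
  qed
  have f': "fst \<in> ref_measure \<rightarrow>\<^sub>M borel"
    unfolding ref_measure_def
    by (rule measurable_compose[OF measurable_fst]) (auto intro: measurable_restrict_space1)
  have s': "snd \<in> ref_measure \<rightarrow>\<^sub>M borel"
    unfolding ref_measure_def by (rule measurable_compose[OF measurable_snd]) auto
  have "(\<lambda>w. w) \<in> ref_measure \<rightarrow>\<^sub>M borel"
  proof (rule borel_measurableI)
    fix S :: "(real \<times> int) set" assume S: "open S"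
    have "{x. (x, y) \<in> S} \<in> sets borel" for y
    proof -
      have "open ((\<lambda>x. (x, y)) -` S)"
        by (intro open_vimage[OF S] continuous_intros)
      then show ?thesis by (simp add: vimage_def)
    qed
    then have "(fst -` {x. (x, y) \<in> S} \<inter> space ref_measure) \<inter>
        (snd -` {y} \<inter> space ref_measure) \<in> sets ref_measure" for y
      by (intro sets.Int measurable_sets[OF f'] measurable_sets[OF s']) auto
    then have "(\<Union>y. (fst -` {x. (x, y) \<in> S} \<inter> space ref_measure) \<inter>
        (snd -` {y} \<inter> space ref_measure)) \<in> sets ref_measure"
      by (intro sets.countable_UN'') auto
    also have "(\<Union>y. (fst -` {x. (x, y) \<in> S} \<inter> space ref_measure) \<inter>
        (snd -` {y} \<inter> space ref_measure)) = (\<lambda>w. w) -` S \<inter> space ref_measure"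
      by auto
    finally show "(\<lambda>w. w) -` S \<inter> space ref_measure \<in> sets ref_measure" .
  qed
  then have id2: "(\<lambda>w. w) \<in> ref_measure \<rightarrow>\<^sub>M Omega_borel"
    unfolding Omega_borel_def
    by (intro measurable_restrict_space2) (auto simp: space_ref_measure)
  show "sets Omega_borel \<subseteq> sets ref_measure"
  proof
    fix A assume A: "A \<in> sets Omega_borel"
    then have "A \<subseteq> Omega" using sets.sets_into_space space_Omega_borel by blast
    then show "A \<in> sets ref_measure"
      using measurable_sets[OF id2 A] by (simp add: space_ref_measure Int_absorb2)
  qed
qed

lemma C1_Omega_continuous_slice:
  assumes "C1_Omega f" "y \<in> {-1, 1}"
  shows "continuous_on {0..1} (\<lambda>t. f (t, y))"
  using assms unfolding C1_Omega_def Omega_def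
  by (auto simp: continuous_on_eq_continuous_within intro!: differentiable_imp_continuous_within)

lemma C1_Omega_continuous:
  assumes "C1_Omega f"
  shows "continuous_on Omega f"
proof -
  have E: "Omega = {0..1} \<times> {-1} \<union> {0..1} \<times> {1}"
    by (auto simp: Omega_def)
  have "continuous_on ({0..1} \<times> {y}) f" if "y \<in> {-1, 1}" for y
  proof -
    have "continuous_on ({0..1} \<times> {y}) (\<lambda>w. f (fst w, y))"
      by (rule continuous_on_compose2[OF C1_Omega_continuous_slice[OF assms that]])
         (auto intro!: continuous_intros)
    then show ?thesis
      by (rule continuous_on_cong[THEN iffD1, rotated 2]) auto
  qed
  then show ?thesis
    unfolding E by (intro continuous_on_closed_Un) (auto intro!: closed_Times)
qed

lemma C1_Omega_measurable:
  assumes "C1_Omega f"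
  shows "f \<in> borel_measurable ref_measure"
proof -
  have "f \<in> borel_measurable Omega_borel"
    unfolding Omega_borel_def
    by (rule borel_measurable_continuous_on_restrict[OF C1_Omega_continuous[OF assms]])
  then show ?thesis
    using measurable_cong_sets[OF sets_ref_measure refl] by blast
qed

lemma is_C1_density_unique:
  assumes f: "is_C1_density P f" and g: "is_C1_density P g" and w: "w \<in> Omega"
  shows "f w = g w"
proof -
  let ?L = "restrict_space lborel {0..1::real}"
  interpret L: sigma_finite_measure ?L
    by (rule sigma_finite_measure_restrict_space[OF sigma_finite_lborel]) simp
  interpret C: sigma_finite_measure "count_space {-1, 1::int}"
    by (rule sigma_finite_measure_count_space_countable) simp
  interpret LC: pair_sigma_finite ?L "count_space {-1, 1::int}" ..
  have c: "C1_Omega f" "C1_Omega g" and nn: "\<forall>w\<in>Omega. 0 \<le> f w" "\<forall>w\<in>Omega. 0 \<le> g w"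
    using f g by (auto simp: is_C1_density_def)
  have "density ref_measure (\<lambda>w. ennreal (f w)) = density ref_measure (\<lambda>w. ennreal (g w))"
    using f g by (auto simp: is_C1_density_def)
  then have "AE w in ref_measure. ennreal (f w) = ennreal (g w)"
    unfolding ref_measure_def
    by (subst (asm) LC.density_unique_iff)
       (use c[THEN C1_Omega_measurable] in \<open>auto simp: ref_measure_def\<close>)
  then have "AE x in ?L. AE y in count_space {-1, 1}. ennreal (f (x, y)) = ennreal (g (x, y))"
    unfolding ref_measure_def by (rule LC.AE_pair)
  then have ae: "AE x in lborel. x \<in> {0..1} \<longrightarrow>
      (\<forall>y\<in>{-1, 1}. ennreal (f (x, y)) = ennreal (g (x, y)))"
    by (auto simp: AE_restrict_space_iff AE_count_space)
  obtain x0 y where w_eq: "w = (x0, y)" and x0: "x0 \<in> {0..1}" and y: "y \<in> {-1, 1}"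
    using w by (auto simp: Omega_def)
  have ae_y: "AE x in lborel. x \<in> {0..1} \<longrightarrow> f (x, y) = g (x, y)"
    using ae
  proof eventually_elim
    case (elim x)
    show ?case
    proof
      assume x: "x \<in> {0..1}"
      then have "0 \<le> f (x, y)" "0 \<le> g (x, y)"
        using nn y by (auto simp: Omega_def)
      moreover have "ennreal (f (x, y)) = ennreal (g (x, y))"
        using elim x y by blast
      ultimately show "f (x, y) = g (x, y)" by simp
    qed
  qed
  have cont: "continuous_on {0..1} (\<lambda>x. f (x, y) - g (x, y))"
    using C1_Omega_continuous_slice[OF c(1) y] C1_Omega_continuous_slice[OF c(2) y]
    by (intro continuous_intros)
  have "f (x0, y) - g (x0, y) = 0"
  proof (rule ccontr)
    assume ne: "f (x0, y) - g (x0, y) \<noteq> 0"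
    then obtain e where e: "e > 0"
      and far: "\<And>x. x \<in> {0..1} \<Longrightarrow> dist x x0 < e \<Longrightarrow>
        dist (f (x, y) - g (x, y)) (f (x0, y) - g (x0, y)) < \<bar>f (x0, y) - g (x0, y)\<bar>"
      using cont x0 unfolding continuous_on_iff by (meson zero_less_abs_iff)
    define l r where "l = max 0 (x0 - e)" and "r = min 1 (x0 + e)"
    have lr: "l < r" using e x0 by (auto simp: l_def r_def)
    have "AE x in lborel. x \<notin> {l<..<r}"
      using ae_y
    proof eventually_elim
      case (elim x)
      show ?case
      proof
        assume x: "x \<in> {l<..<r}"
        then have "x \<in> {0..1}" "dist x x0 < e"
          by (auto simp: l_def r_def dist_real_def)
        then show False using far[of x] elim by (auto simp: dist_real_def)
      qed
    qed
    then have "emeasure lborel {l<..<r} = 0"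
      by (subst (asm) AE_iff_measurable[where N="{l<..<r}"]) auto
    then show False using lr by simp
  qed
  then show ?thesis by (simp add: w_eq)
qed

lemma is_C1_density_dens: "P \<in> calP_tilde \<Longrightarrow> is_C1_density P (dens P)"
  unfolding dens_def calP_tilde_def by (auto simp: someI_ex[of "is_C1_density P"])

lemma compact_Omega: "compact Omega"
  unfolding Omega_def by (intro compact_Times) (auto intro: finite_imp_compact)

lemma calP_tilde_continuous:
  assumes "P \<in> calP_tilde"
  shows "continuous_on Omega (dens P)" "continuous_on Omega (partial1 (dens P))"
  using is_C1_density_dens[OF assms] C1_Omega_continuous
  by (auto simp: is_C1_density_def C1_Omega_def)

lemma Metric_space_dist_P: "Metric_space calP_tilde dist_P"
proof -
  define S where "S h = (SUP w\<in>Omega. \<bar>h w :: real\<bar>)" for h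
  have ne: "(0, 1) \<in> Omega" by (simp add: Omega_def)
  have up: "\<bar>h w\<bar> \<le> S h" if "continuous_on Omega h" "w \<in> Omega" for h w
    unfolding S_def
  proof (rule cSUP_upper[OF that(2)])
    have "compact ((\<lambda>w. \<bar>h w\<bar>) ` Omega)"
      using that(1) by (intro compact_continuous_image compact_Omega continuous_intros)
    then show "bdd_above ((\<lambda>w. \<bar>h w\<bar>) ` Omega)"
      by (intro bounded_imp_bdd_above compact_imp_bounded)
  qed
  have least: "S h \<le> b" if "\<And>w. w \<in> Omega \<Longrightarrow> \<bar>h w\<bar> \<le> b" for h b
    unfolding S_def using ne that by (intro cSUP_least) auto
  have S0: "0 \<le> S h" if "continuous_on Omega h" for h
    using up[OF that ne] by linarith
  have tri: "S (\<lambda>w. a w - c w) \<le> S (\<lambda>w. a w - b w) + S (\<lambda>w. b w - c w)"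
    if "continuous_on Omega a" "continuous_on Omega b" "continuous_on Omega c" for a b c
  proof (rule least)
    fix w assume w: "w \<in> Omega"
    have "\<bar>a w - b w\<bar> \<le> S (\<lambda>w. a w - b w)" "\<bar>b w - c w\<bar> \<le> S (\<lambda>w. b w - c w)"
      using that w by (auto intro!: up continuous_intros)
    then show "\<bar>a w - c w\<bar> \<le> S (\<lambda>w. a w - b w) + S (\<lambda>w. b w - c w)" by linarith
  qed
  have d: "dist_P P Q = (if P \<in> calP_tilde \<and> Q \<in> calP_tilde
      then S (\<lambda>w. dens P w - dens Q w)
         + S (\<lambda>w. partial1 (dens P) w - partial1 (dens Q) w) else 0)" for P Q
    by (simp add: dist_P_def S_def)
  note cont = calP_tilde_continuous
  show ?thesis
  proof
    fix P Q show "0 \<le> dist_P P Q"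
      unfolding d by (auto intro!: add_nonneg_nonneg S0 continuous_intros cont)
  next
    fix P Q show "dist_P P Q = dist_P Q P"
      unfolding dist_P_def by (simp add: abs_minus_commute conj_commute)
  next
    fix P Q assume P: "P \<in> calP_tilde" and Q: "Q \<in> calP_tilde"
    show "dist_P P Q = 0 \<longleftrightarrow> P = Q"
    proof
      assume "dist_P P Q = 0"
      moreover have "0 \<le> S (\<lambda>w. partial1 (dens P) w - partial1 (dens Q) w)"
        by (auto intro!: S0 continuous_intros cont P Q)
      ultimately have "S (\<lambda>w. dens P w - dens Q w) \<le> 0"
        using P Q by (simp add: d)
      moreover have "\<bar>dens P w - dens Q w\<bar> \<le> S (\<lambda>w. dens P w - dens Q w)"
        if "w \<in> Omega" for w
        using that by (auto intro!: up[of "\<lambda>w. dens P w - dens Q w"] continuous_intros cont P Q)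
      ultimately have eq: "dens P w = dens Q w" if "w \<in> Omega" for w
        using that by fastforce
      have "density ref_measure (\<lambda>w. ennreal (dens P w)) =
            density ref_measure (\<lambda>w. ennreal (dens Q w))"
        using is_C1_density_dens[OF P] is_C1_density_dens[OF Q]
        by (intro density_cong)
           (auto simp: is_C1_density_def space_ref_measure eq intro!: measurable_compose[OF C1_Omega_measurable measurable_ennreal] AE_I2)
      then show "P = Q"
        using is_C1_density_dens[OF P] is_C1_density_dens[OF Q]
        by (simp add: is_C1_density_def)
    next
      assume "P = Q"
      moreover have "S (\<lambda>w. 0) = 0"
        unfolding S_def using ne by (subst abs_zero, subst cSUP_const) auto
      ultimately show "dist_P P Q = 0" by (simp add: d)
    qed
  next
    fix P Q R assume "P \<in> calP_tilde" "Q \<in> calP_tilde" "R \<in> calP_tilde"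
    then show "dist_P P R \<le> dist_P P Q + dist_P Q R"
      using tri[of "dens P" "dens Q" "dens R"]
        tri[of "partial1 (dens P)" "partial1 (dens Q)" "partial1 (dens R)"]
      by (auto simp: d cont)
  qed
qed

end

(* Perturb a density f of some P in U antisymmetrically: f + h at label 1 and f - h at label -1, where
   h is a bump of width and height proportional to w, centred at the crossing point. The total mass is
   preserved for free, the C^1-distance is a small constant, and the crossing point moves by at least
   kappa * w. Since f is positive at the crossing point, one observation contributes only O(w^3) to the
   squared Hellinger distance, so with w of order (|log(11 delta)| / n)^(1/3) the two n-fold products
   cannot be told apart with error probabilities below delta. *)

theory Submission
  imports Defs
begin

text \<open>The exponent three comes from the metric. A ball for the C^1-distance caps the slope of
  \<open>h\<close>, so its height can only be a small multiple of its width, and the integral of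
  \<open>h^2 / f\<close> over a window of length \<open>2 * w\<close> is of order
  \<open>w^3\<close>. The logarithm dictates how the products are compared. A bound by
  \<open>n\<close> times a one-observation distance says nothing once \<open>n * w^3\<close> exceeds
  a constant. The affinity, the integral of the square root of the likelihood ratio, multiplies over
  independent observations and so stays above the exponential of a negative multiple of
  \<open>n * w^3\<close>, which is still informative for arbitrarily small \<open>\<delta>\<close>.
  The measure \<open>P\<close> is chosen once; only the alternative depends on \<open>n\<close> and
  \<open>\<delta>\<close>. Hence the constants of the perturbation, and with them \<open>c1\<close>,
  are available before \<open>\<delta>\<close> and the estimators are given. Since
  \<open>ln (11 * \<delta>)\<close> vanishes at \<open>\<delta> = 1 / 11\<close>, the width is built
  from \<open>\<bar>ln (11 * \<delta>)\<bar> + 1\<close>; the numerical constants leave room for the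
  extra 1.\<close>

section \<open>Product measures and testing between two hypotheses\<close>

text \<open>Both measures agree on rectangles, where the integral factorises, and rectangles
  determine a product measure. This makes the likelihood ratio of a sample the product of the
  individual ratios.\<close>

lemma PiM_density:
  fixes M :: "'a measure" and \<rho> :: "'a \<Rightarrow> real"
  assumes M: "prob_space M" and N: "prob_space (density M (\<lambda>x. ennreal (\<rho> x)))"
    and \<rho>[measurable]: "\<rho> \<in> borel_measurable M" and nonneg: "\<And>x. 0 \<le> \<rho> x" and I: "finite I"
  shows "(\<Pi>\<^sub>M i\<in>I. density M (\<lambda>x. ennreal (\<rho> x))) =
    density (\<Pi>\<^sub>M i\<in>I. M) (\<lambda>\<omega>. ennreal (\<Prod>i\<in>I. \<rho> (\<omega> i)))"
proof -
  let ?N = "density M (\<lambda>x. ennreal (\<rho> x))"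
  interpret M: product_prob_space "\<lambda>_. M" I by (intro product_prob_spaceI M)
  interpret N: product_prob_space "\<lambda>_. ?N" I by (intro product_prob_spaceI N)
  have sets_eq: "sets (\<Pi>\<^sub>M i\<in>I. ?N) = sets (\<Pi>\<^sub>M i\<in>I. M)"
    by (intro sets_PiM_cong) auto
  have "density (\<Pi>\<^sub>M i\<in>I. M) (\<lambda>\<omega>. ennreal (\<Prod>i\<in>I. \<rho> (\<omega> i))) = (\<Pi>\<^sub>M i\<in>I. ?N)"
  proof (rule N.PiM_eqI[OF I])
    show "sets (density (\<Pi>\<^sub>M i\<in>I. M) (\<lambda>\<omega>. ennreal (\<Prod>i\<in>I. \<rho> (\<omega> i)))) = sets (\<Pi>\<^sub>M i\<in>I. ?N)"
      by (simp add: sets_eq)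
    fix A :: "_ \<Rightarrow> 'a set" assume "\<And>i. i \<in> I \<Longrightarrow> A i \<in> sets ?N"
    then have A[measurable]: "\<And>i. i \<in> I \<Longrightarrow> A i \<in> sets M" by simp
    have "emeasure (density (\<Pi>\<^sub>M i\<in>I. M) (\<lambda>\<omega>. ennreal (\<Prod>i\<in>I. \<rho> (\<omega> i)))) (Pi\<^sub>E I A) =
        (\<integral>\<^sup>+\<omega>. ennreal (\<Prod>i\<in>I. \<rho> (\<omega> i)) * indicator (Pi\<^sub>E I A) \<omega> \<partial>(\<Pi>\<^sub>M i\<in>I. M))"
      using I by (intro emeasure_density) (auto intro!: sets_PiM_I_finite)
    also have "\<dots> = (\<integral>\<^sup>+\<omega>. (\<Prod>i\<in>I. ennreal (\<rho> (\<omega> i)) * indicator (A i) (\<omega> i)) \<partial>(\<Pi>\<^sub>M i\<in>I. M))"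
    proof (rule nn_integral_cong)
      fix \<omega> assume "\<omega> \<in> space (\<Pi>\<^sub>M i\<in>I. M)"
      then have "indicator (Pi\<^sub>E I A) \<omega> = (\<Prod>i\<in>I. indicator (A i) (\<omega> i) :: ennreal)"
        using I by (auto simp: indicator_def space_PiM PiE_iff prod_zero_iff)
      then show "ennreal (\<Prod>i\<in>I. \<rho> (\<omega> i)) * indicator (Pi\<^sub>E I A) \<omega> =
          (\<Prod>i\<in>I. ennreal (\<rho> (\<omega> i)) * indicator (A i) (\<omega> i))"
        by (simp add: prod.distrib prod_ennreal nonneg)
    qed
    also have "\<dots> = (\<Prod>i\<in>I. \<integral>\<^sup>+x. ennreal (\<rho> x) * indicator (A i) x \<partial>M)"
      by (rule M.product_nn_integral_prod[OF I]) simp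
    also have "\<dots> = (\<Prod>i\<in>I. emeasure ?N (A i))"
      by (intro prod.cong refl emeasure_density[symmetric]) auto
    finally show "emeasure (density (\<Pi>\<^sub>M i\<in>I. M) (\<lambda>\<omega>. ennreal (\<Prod>i\<in>I. \<rho> (\<omega> i)))) (Pi\<^sub>E I A) =
        (\<Prod>i\<in>I. emeasure ?N (A i))" .
  qed
  then show ?thesis by simp
qed

text \<open>Le Cam's inequality, obtained from \<open>\<surd>R = \<surd>(min 1 R \<cdot> max 1 R)\<close> and Cauchy--Schwarz;
  note that \<open>min 1 R + max 1 R = 1 + R\<close> has integral \<open>2\<close>.\<close>

lemma (in prob_space) le_cam_inequality:
  fixes R :: "'a \<Rightarrow> real" and \<theta> :: real
  assumes R[measurable]: "integrable M R" and nonneg: "\<And>x. 0 \<le> R x" and R1: "expectation R = 1"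
    and \<theta>: "0 < \<theta>" "\<theta> < 1" and B: "\<theta> * (2 - \<theta>) \<le> (expectation (\<lambda>x. sqrt (R x)))\<^sup>2"
  shows "\<theta> \<le> expectation (\<lambda>x. min 1 (R x))"
proof (rule ccontr)
  define m where "m = expectation (\<lambda>x. min 1 (R x))"
  \<comment> \<open>This weight balances the two terms of the arithmetic-geometric mean bound at
    \<open>m = \<theta>\<close>, where \<open>c * \<theta> = (2 - \<theta>) / c\<close>. As
    \<open>c > 1\<close>, the bound increases with \<open>m\<close>, so \<open>m < \<theta>\<close>
    yields a strict inequality.\<close>
  define c where "c = sqrt ((2 - \<theta>) / \<theta>)"
  assume "\<not> \<theta> \<le> expectation (\<lambda>x. min 1 (R x))"
  then have m: "m < \<theta>" by (simp add: m_def)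
  have c: "1 < c" using \<theta> by (simp add: c_def)
  have c2: "c * c = (2 - \<theta>) / \<theta>" using \<theta> by (simp add: c_def)
  have [measurable]: "R \<in> borel_measurable M" using R by auto
  have int_min: "integrable M (\<lambda>x. min 1 (R x))" using R by auto
  have int_max: "integrable M (\<lambda>x. max 1 (R x))" using R by auto
  have "expectation (\<lambda>x. max 1 (R x)) = expectation (\<lambda>x. (1 + R x) - min 1 (R x))"
    by (intro Bochner_Integration.integral_cong) auto
  also have "\<dots> = 2 - m"
    using R int_min by (simp add: R1 m_def prob_space)
  finally have max: "expectation (\<lambda>x. max 1 (R x)) = 2 - m" .
  have sqrt_le: "sqrt (R x) \<le> (c * min 1 (R x) + max 1 (R x) / c) / 2" for x
  proof -
    have eq: "R x = (c * min 1 (R x)) * (max 1 (R x) / c)"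
      using c by (auto simp: min_def max_def)
    have "sqrt ((c * min 1 (R x)) * (max 1 (R x) / c)) \<le> (c * min 1 (R x) + max 1 (R x) / c) / 2"
      using c nonneg[of x] by (intro arith_geo_mean_sqrt) auto
    then show ?thesis using eq by simp
  qed
  have "expectation (\<lambda>x. sqrt (R x)) \<le> expectation (\<lambda>x. (c * min 1 (R x) + max 1 (R x) / c) / 2)"
    using int_min int_max c nonneg by (intro integral_mono' sqrt_le) auto
  also have "\<dots> = (c * m + (2 - m) / c) / 2"
    using int_min int_max by (simp add: m_def max)
  also have "\<dots> < (c * \<theta> + (2 - \<theta>) / c) / 2"
  proof -
    have "(\<theta> - m) * (1 / c) < (\<theta> - m) * c"
      using m c less_trans[of "1/c" 1 c] by (intro mult_strict_left_mono) auto
    then have "c * m + (2 - m) / c < c * \<theta> + (2 - \<theta>) / c"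
      by (simp add: algebra_simps diff_divide_distrib)
    then show ?thesis by (simp only: divide_strict_right_mono zero_less_numeral)
  qed
  also have "\<dots> = c * \<theta>"
    using c2 c \<theta> by (simp add: field_simps)
  finally have lt: "expectation (\<lambda>x. sqrt (R x)) < c * \<theta>" .
  have "(expectation (\<lambda>x. sqrt (R x)))\<^sup>2 < (c * \<theta>)\<^sup>2"
    using lt nonneg by (intro power_strict_mono Bochner_Integration.integral_nonneg) auto
  also have "\<dots> = (c * c) * \<theta> * \<theta>"
    by (simp add: power2_eq_square)
  also have "\<dots> = \<theta> * (2 - \<theta>)"
    using \<theta> by (simp add: c2)
  finally show False using B by simp
qed

lemma (in finite_measure) integrable_sqrt:
  fixes f :: "'a \<Rightarrow> real"
  assumes f: "integrable M f" and nonneg: "\<And>x. 0 \<le> f x"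
  shows "integrable M (\<lambda>x. sqrt (f x))"
proof (rule Bochner_Integration.integrable_bound)
  show "integrable M (\<lambda>x. 1 + f x)" using f by simp
  show "AE x in M. norm (sqrt (f x)) \<le> norm (1 + f x)"
  proof (rule AE_I2)
    fix x
    have "sqrt (1 * f x) \<le> (1 + f x) / 2"
      by (rule arith_geo_mean_sqrt) (auto simp: nonneg)
    then show "norm (sqrt (f x)) \<le> norm (1 + f x)" using nonneg[of x] by simp
  qed
qed (use f in auto)

text \<open>As \<open>A0\<close> and \<open>A1\<close> cover the space, \<open>min 1 R\<close> is
  pointwise at most the indicator of \<open>A0\<close> plus \<open>R\<close> times that of
  \<open>A1\<close>; Le Cam's inequality bounds its integral from below. In the application these
  are the failure events under the two hypotheses. The affinity of the products is a power of the
  single one and enters squared, hence the exponent \<open>2 * card I\<close>.\<close>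

lemma two_point_lower_bound:
  fixes M :: "'a measure" and \<rho> :: "'a \<Rightarrow> real" and \<theta> :: real
  assumes M: "prob_space M" and N: "prob_space (density M (\<lambda>x. ennreal (\<rho> x)))"
    and \<rho>[measurable]: "\<rho> \<in> borel_measurable M" and nonneg: "\<And>x. 0 \<le> \<rho> x" and I: "finite I"
    and \<theta>: "0 < \<theta>" "\<theta> < 1"
    and B: "\<theta> * (2 - \<theta>) \<le> (\<integral>x. sqrt (\<rho> x) \<partial>M) ^ (2 * card I)"
    and A0: "A0 \<in> sets (\<Pi>\<^sub>M i\<in>I. M)" and A1: "A1 \<in> sets (\<Pi>\<^sub>M i\<in>I. M)"
    and cover: "space (\<Pi>\<^sub>M i\<in>I. M) \<subseteq> A0 \<union> A1"
  shows "ennreal \<theta> \<le> emeasure (\<Pi>\<^sub>M i\<in>I. M) A0 +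
    emeasure (\<Pi>\<^sub>M i\<in>I. density M (\<lambda>x. ennreal (\<rho> x))) A1"
proof -
  interpret M: prob_space M by (rule M)
  interpret P: prob_space "\<Pi>\<^sub>M i\<in>I. M" by (intro prob_space_PiM M)
  interpret MI: product_prob_space "\<lambda>_. M" I by (intro product_prob_spaceI M)
  define R where "R \<omega> = (\<Prod>i\<in>I. \<rho> (\<omega> i))" for \<omega>
  have R_meas[measurable]: "R \<in> borel_measurable (\<Pi>\<^sub>M i\<in>I. M)"
    unfolding R_def by measurable
  have R_nonneg: "0 \<le> R \<omega>" for \<omega> by (simp add: R_def prod_nonneg nonneg)
  have "(\<integral>\<^sup>+x. ennreal (\<rho> x) \<partial>M) = 1"
    using prob_space.emeasure_space_1[OF N] by (simp add: emeasure_density cong: nn_integral_cong)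
  then have has: "integrable M \<rho>" "(\<integral>x. \<rho> x \<partial>M) = 1"
    using nn_integral_eq_integrable[of \<rho> M 1] nonneg by auto
  have sqrt_int: "integrable M (\<lambda>x. sqrt (\<rho> x))"
    by (intro M.integrable_sqrt has(1) nonneg)
  have R_int: "integrable (\<Pi>\<^sub>M i\<in>I. M) R"
    unfolding R_def by (rule MI.product_integrable_prod[OF I]) (rule has)
  have "P.expectation R = 1"
    unfolding R_def by (subst MI.product_integral_prod[OF I]) (auto simp: has)
  moreover have "P.expectation (\<lambda>\<omega>. sqrt (R \<omega>)) = (\<integral>x. sqrt (\<rho> x) \<partial>M) ^ card I"
  proof -
    have "sqrt (R \<omega>) = (\<Prod>i\<in>I. sqrt (\<rho> (\<omega> i)))" for \<omega>
      unfolding R_def using I by (induction I) (auto simp: real_sqrt_mult)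
    then show ?thesis
      by (simp only:) (subst MI.product_integral_prod[OF I], auto simp: sqrt_int)
  qed
  ultimately have "\<theta> \<le> P.expectation (\<lambda>\<omega>. min 1 (R \<omega>))"
    using B by (intro P.le_cam_inequality R_int R_nonneg \<theta>) (auto simp: power_mult power_commutes mult.commute)
  also have "ennreal \<dots> = (\<integral>\<^sup>+\<omega>. ennreal (min 1 (R \<omega>)) \<partial>(\<Pi>\<^sub>M i\<in>I. M))"
    using R_int R_nonneg by (intro nn_integral_eq_integral[symmetric]) auto
  also have "\<dots> \<le> (\<integral>\<^sup>+\<omega>. indicator A0 \<omega> + ennreal (R \<omega>) * indicator A1 \<omega> \<partial>(\<Pi>\<^sub>M i\<in>I. M))"
  proof (rule nn_integral_mono)
    fix \<omega> assume "\<omega> \<in> space (\<Pi>\<^sub>M i\<in>I. M)"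
    then have "\<omega> \<in> A0 \<or> \<omega> \<in> A1" using cover by blast
    moreover have "ennreal (min 1 (R \<omega>)) \<le> 1" "ennreal (min 1 (R \<omega>)) \<le> ennreal (R \<omega>)"
      by (auto simp: R_nonneg intro!: ennreal_leI)
    ultimately show "ennreal (min 1 (R \<omega>)) \<le> indicator A0 \<omega> + ennreal (R \<omega>) * indicator A1 \<omega>"
      by (auto simp: indicator_def intro: add_increasing2)
  qed
  also have "\<dots> = emeasure (\<Pi>\<^sub>M i\<in>I. M) A0 + emeasure (density (\<Pi>\<^sub>M i\<in>I. M) (\<lambda>\<omega>. ennreal (R \<omega>))) A1"
    using A0 A1 by (simp add: nn_integral_add emeasure_density)
  finally show ?thesis
    unfolding R_def PiM_density[OF M N \<rho> nonneg I] by (simp add: ennreal_leI)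
qed

section \<open>The bump and the displaced zero\<close>

text \<open>For \<open>w > 0\<close> this is \<open>w * \<phi> ((x - a) / w)\<close> with profile
  \<open>\<phi> u = (max 0 (1 - u^2))^2\<close>: height and width scale together while the maximal
  slope does not depend on \<open>w\<close>. Squaring the positive part gives C^1 smoothness at the
  edge of the support.\<close>

definition bump :: "real \<Rightarrow> real \<Rightarrow> real \<Rightarrow> real" where
  "bump a w x = (max 0 (w\<^sup>2 - (x - a)\<^sup>2))\<^sup>2 / w ^ 3"

definition bump_deriv :: "real \<Rightarrow> real \<Rightarrow> real \<Rightarrow> real" where
  "bump_deriv a w x = - 4 * (x - a) * max 0 (w\<^sup>2 - (x - a)\<^sup>2) / w ^ 3"

lemma has_real_derivative_max_0_square:
  "((\<lambda>t::real. (max 0 t)\<^sup>2) has_real_derivative 2 * max 0 t) (at t)"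
proof -
  consider "t < 0" | "t = 0" | "t > 0" by linarith
  then show ?thesis
  proof cases
    case 1
    have "((\<lambda>t::real. 0) has_real_derivative 0) (at t)" by simp
    then have "((\<lambda>t::real. (max 0 t)\<^sup>2) has_real_derivative 0) (at t)"
      by (rule has_field_derivative_transform_within_open[where S = "{..<0}"]) (use 1 in auto)
    then show ?thesis using 1 by simp
  next
    case 2
    have "isCont (\<lambda>z::real. max 0 z) 0" by (intro continuous_intros)
    moreover have "(max 0 z)\<^sup>2 - (max 0 0)\<^sup>2 = max 0 z * (z - 0)" for z :: real
      by (simp add: max_def power2_eq_square)
    ultimately have "((\<lambda>t::real. (max 0 t)\<^sup>2) has_real_derivative 0) (at 0)"
      by (subst CARAT_DERIV) (intro exI[of _ "\<lambda>z. max 0 z"], auto)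
    then show ?thesis using 2 by simp
  next
    case 3
    have "((\<lambda>t::real. t\<^sup>2) has_real_derivative 2 * t) (at t)"
      by (auto intro!: derivative_eq_intros)
    then have "((\<lambda>t::real. (max 0 t)\<^sup>2) has_real_derivative 2 * t) (at t)"
      by (rule has_field_derivative_transform_within_open[where S = "{0<..}"]) (use 3 in auto)
    then show ?thesis using 3 by simp
  qed
qed

lemma bump_has_derivative:
  "(bump a w has_real_derivative bump_deriv a w x) (at x)"
proof -
  have "((\<lambda>x. w\<^sup>2 - (x - a)\<^sup>2) has_real_derivative - 2 * (x - a)) (at x)"
    by (auto intro!: derivative_eq_intros)
  from DERIV_chain2[OF has_real_derivative_max_0_square this]
  have "((\<lambda>x. (max 0 (w\<^sup>2 - (x - a)\<^sup>2))\<^sup>2 / w ^ 3) has_real_derivative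
      2 * max 0 (w\<^sup>2 - (x - a)\<^sup>2) * (- 2 * (x - a)) / w ^ 3) (at x)"
    by (rule DERIV_cdivide)
  then show ?thesis
    unfolding bump_def[abs_def] bump_deriv_def by (simp add: algebra_simps)
qed

lemma continuous_on_bump_deriv: "w > 0 \<Longrightarrow> continuous_on S (bump_deriv a w)"
  unfolding bump_deriv_def[abs_def] by (intro continuous_intros) auto

lemma bump_nonneg: "w > 0 \<Longrightarrow> 0 \<le> bump a w x"
  by (simp add: bump_def)

lemma bump_le: assumes "w > 0" shows "bump a w x \<le> w"
proof -
  have "(max 0 (w\<^sup>2 - (x - a)\<^sup>2))\<^sup>2 \<le> (w\<^sup>2)\<^sup>2"
    by (rule power_mono) auto
  then show ?thesis
    using assms by (simp add: bump_def divide_le_eq power2_eq_square power3_eq_cube mult.assoc)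
qed

lemma bump_eq_0: assumes "w > 0" "w \<le> \<bar>x - a\<bar>" shows "bump a w x = 0"
proof -
  have "w\<^sup>2 \<le> \<bar>x - a\<bar>\<^sup>2" using assms by (intro power_mono) auto
  then show ?thesis by (simp add: bump_def)
qed

text \<open>At half the radius the profile is still \<open>(1 - 1/4)^2 = 9/16\<close>, which is
  rounded down to \<open>1/2\<close>.\<close>

lemma bump_ge: assumes "w > 0" "\<bar>x - a\<bar> \<le> w / 2" shows "w / 2 \<le> bump a w x"
proof -
  have "\<bar>x - a\<bar>\<^sup>2 \<le> (w / 2)\<^sup>2" using assms by (intro power_mono) auto
  then have "3 / 4 * w\<^sup>2 \<le> w\<^sup>2 - (x - a)\<^sup>2" by (simp add: power_divide)
  then have "3 / 4 * w\<^sup>2 \<le> max 0 (w\<^sup>2 - (x - a)\<^sup>2)" by linarith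
  then have "(3 / 4 * w\<^sup>2)\<^sup>2 \<le> (max 0 (w\<^sup>2 - (x - a)\<^sup>2))\<^sup>2" by (rule power_mono) simp
  then have "(3 / 4 * w\<^sup>2)\<^sup>2 / w ^ 3 \<le> bump a w x"
    unfolding bump_def using assms by (intro divide_right_mono) auto
  moreover have "(3 / 4 * w\<^sup>2)\<^sup>2 / w ^ 3 = 9 / 16 * w"
    using assms by (simp add: power2_eq_square power3_eq_cube)
  ultimately show ?thesis using assms by linarith
qed

lemma abs_bump_deriv_le: assumes "w > 0" shows "\<bar>bump_deriv a w x\<bar> \<le> 4"
proof (cases "\<bar>x - a\<bar> \<le> w")
  case True
  have "\<bar>x - a\<bar> * max 0 (w\<^sup>2 - (x - a)\<^sup>2) \<le> w * w\<^sup>2"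
    using True assms by (intro mult_mono) auto
  then have "4 * (\<bar>x - a\<bar> * max 0 (w\<^sup>2 - (x - a)\<^sup>2)) \<le> 4 * w ^ 3"
    by (simp add: power2_eq_square power3_eq_cube)
  moreover have "\<bar>bump_deriv a w x\<bar> = 4 * (\<bar>x - a\<bar> * max 0 (w\<^sup>2 - (x - a)\<^sup>2)) / w ^ 3"
    using assms unfolding bump_deriv_def by (simp only: abs_mult abs_divide) simp
  ultimately show ?thesis
    using assms by (simp add: divide_le_eq)
next
  case False
  then have "w\<^sup>2 \<le> \<bar>x - a\<bar>\<^sup>2" using assms by (intro power_mono) auto
  then show ?thesis by (simp add: bump_deriv_def)
qed

text \<open>Here \<open>g\<close> stands for the difference of the two label densities, so an
  antisymmetric change by \<open>k\<close> adds \<open>2 * k\<close>. Inside the window the sum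
  still increases, because \<open>2 * k'\<close> is at most \<open>s / 4\<close> in size against a
  slope above \<open>s / 2\<close>; outside it equals \<open>g\<close>, whose only zero is
  \<open>a\<close>. So a sign change to the left of \<open>a\<close> gives the unique zero.\<close>

lemma perturbed_zero:
  fixes g g' k k' :: "real \<Rightarrow> real"
  assumes w: "0 < w" "{a - w..a + w} \<subseteq> {0<..<1}"
    and g: "\<And>x. x \<in> {0..1} \<Longrightarrow> (g has_real_derivative g' x) (at x within {0..1})"
    and g': "\<And>x. \<bar>x - a\<bar> \<le> w \<Longrightarrow> s / 2 < g' x \<and> g' x < 2 * s"
    and zero: "g a = 0" "\<And>x. x \<in> {0..1} \<Longrightarrow> g x = 0 \<Longrightarrow> x = a"
    and k: "\<And>x. (k has_real_derivative k' x) (at x)" "\<And>x. \<bar>k' x\<bar> \<le> s / 8"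
    and supp: "\<And>x. w \<le> \<bar>x - a\<bar> \<Longrightarrow> k x = 0"
    and large: "\<And>x. \<bar>x - a\<bar> \<le> w / 2 \<Longrightarrow> l * w / 2 \<le> k x"
    and \<kappa>: "0 < \<kappa>" "\<kappa> \<le> 1 / 2" "2 * s * \<kappa> \<le> l"
  obtains b where "a - w < b" "b < a - \<kappa> * w" "g b + 2 * k b = 0"
    "\<And>x. x \<in> {0..1} \<Longrightarrow> g x + 2 * k x = 0 \<Longrightarrow> x = b"
proof -
  define G where "G x = g x + 2 * k x" for x
  have s: "s > 0" using g'[of a] w by auto
  have der_g: "(g has_real_derivative g' x) (at x)" if "\<bar>x - a\<bar> \<le> w" for x
  proof -
    have "x \<in> {a - w..a + w}" using that by (auto simp: abs_le_iff)
    with w(2) have x: "x \<in> {0<..<1}" by (rule subsetD)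
    then have "(g has_real_derivative g' x) (at x within {0<..<1})"
      by (intro DERIV_subset[OF g]) (simp_all add: subset_iff)
    then show ?thesis using x at_within_open[of x "{0<..<1}"] by simp
  qed
  have der_G: "(G has_real_derivative g' x + 2 * k' x) (at x)" if "\<bar>x - a\<bar> \<le> w" for x
    unfolding G_def[abs_def] by (intro DERIV_add DERIV_cmult der_g that k)
  have pos: "0 < g' x + 2 * k' x" if "\<bar>x - a\<bar> \<le> w" for x
    using g'[OF that] k(2)[of x] s by linarith
  have inc: "G x < G y" if "a - w \<le> x" "x < y" "y \<le> a + w" for x y
  proof (rule DERIV_pos_imp_increasing[OF that(2)])
    fix z assume "x \<le> z" "z \<le> y"
    then have "\<bar>z - a\<bar> \<le> w" using that by (auto simp: abs_le_iff)
    then show "\<exists>d. (G has_real_derivative d) (at z) \<and> 0 < d" using der_G pos by blast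
  qed
  define t where "t = \<kappa> * w"
  have t: "t \<le> w / 2" "0 < t"
    using mult_right_mono[of \<kappa> "1/2" w] \<kappa> w by (auto simp: t_def)
  have "G (a - w) < 0"
  proof -
    have "g (a - w) < g a"
    proof (rule DERIV_pos_imp_increasing[where f = g])
      show "a - w < a" using w by simp
      fix z assume "a - w \<le> z" "z \<le> a"
      then have "\<bar>z - a\<bar> \<le> w" by (auto simp: abs_le_iff)
      then show "\<exists>d. (g has_real_derivative d) (at z) \<and> 0 < d"
        using der_g[of z] g'[of z] s by (intro exI[of _ "g' z"]) auto
    qed
    then show ?thesis using supp[of "a - w"] w zero by (simp add: G_def)
  qed
  \<comment> \<open>Moving left from \<open>a\<close> by \<open>t\<close> lowers \<open>g\<close> by
    less than \<open>2 * s * t \<le> l * w\<close>, whereas \<open>2 * k\<close> is at least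
    \<open>l * w\<close> there, since \<open>t \<le> w / 2\<close>.\<close>
  moreover have "0 < G (a - t)"
  proof -
    have "(g has_real_derivative g' x) (at x)" if "a - t \<le> x" "x \<le> a" for x
      using that t w by (intro der_g) (auto simp: abs_le_iff)
    then obtain z where z: "a - t < z" "z < a" "g a - g (a - t) = (a - (a - t)) * g' z"
      using MVT2[of "a - t" a g g'] t by auto
    have "g' z < 2 * s" using g'[of z] z t by (auto simp: abs_le_iff)
    then have "t * g' z < t * (2 * s)"
      using t by (intro mult_strict_left_mono)
    moreover have "t * (2 * s) \<le> l * w"
      using mult_right_mono[OF \<kappa>(3), of w] w by (simp add: t_def algebra_simps)
    moreover have "l * w / 2 \<le> k (a - t)"
      using t by (intro large) auto
    moreover have "- g (a - t) = t * g' z"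
      using z(3) zero(1) by simp
    ultimately show ?thesis unfolding G_def by linarith
  qed
  moreover have "continuous_on {a - w..a - t} G"
  proof (rule continuous_at_imp_continuous_on, rule ballI)
    fix x assume "x \<in> {a - w..a - t}"
    then have "\<bar>x - a\<bar> \<le> w" using t by (auto simp: abs_le_iff)
    then show "isCont G x" by (intro DERIV_isCont[OF der_G])
  qed
  ultimately obtain b where b: "a - w \<le> b" "b \<le> a - t" "G b = 0"
    using IVT'[of G "a - w" 0 "a - t"] t by auto
  show thesis
  proof (rule that)
    show "a - w < b" using b \<open>G (a - w) < 0\<close> by (cases "b = a - w") auto
    show "b < a - \<kappa> * w" unfolding t_def[symmetric] using b \<open>0 < G (a - t)\<close> by (cases "b = a - t") auto
    show "g b + 2 * k b = 0" using b by (simp add: G_def)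
    fix x assume x: "x \<in> {0..1}" "g x + 2 * k x = 0"
    show "x = b"
    proof (cases "\<bar>x - a\<bar> \<le> w")
      case True
      then have "a - w \<le> x" "x \<le> a + w" by (auto simp: abs_le_iff)
      moreover have "a - w \<le> b" "b \<le> a + w" using b t w by auto
      ultimately show ?thesis
        using inc[of x b] inc[of b x] x b by (cases x b rule: linorder_cases) (auto simp: G_def)
    next
      case False
      then show ?thesis using supp[of x] zero(2)[of x] x w by auto
    qed
  qed
qed

section \<open>From the chi-square distance to the affinity\<close>

text \<open>The bound \<open>pt\<close> is a second-order expansion of the square root at 1. Its
  linear term integrates to zero because \<open>\<rho>\<close> has mean 1, so only the chi-square
  term remains.\<close>

lemma (in prob_space) expectation_sqrt_ge:
  fixes \<rho> :: "'a \<Rightarrow> real"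
  assumes [measurable]: "\<rho> \<in> borel_measurable M" and nonneg: "\<And>x. 0 \<le> \<rho> x"
    and one: "(\<integral>\<^sup>+x. ennreal (\<rho> x) \<partial>M) = 1"
    and e: "(\<integral>\<^sup>+x. ennreal ((\<rho> x - 1)\<^sup>2) \<partial>M) \<le> ennreal e" "0 \<le> e"
  shows "1 - e / 2 \<le> expectation (\<lambda>x. sqrt (\<rho> x))"
proof -
  have \<rho>: "integrable M \<rho>" "expectation \<rho> = 1"
    using one nn_integral_eq_integrable[of \<rho> M 1] nonneg by auto
  have sq: "integrable M (\<lambda>x. (\<rho> x - 1)\<^sup>2)"
    using e by (intro integrableI_nonneg) (auto intro: le_less_trans)
  then have sq_le: "expectation (\<lambda>x. (\<rho> x - 1)\<^sup>2) \<le> e"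
    using e by (subst (asm) nn_integral_eq_integral) auto
  have pt: "1 + (\<rho> x - 1) / 2 - (\<rho> x - 1)\<^sup>2 / 2 \<le> sqrt (\<rho> x)" for x
  proof -
    define u where "u = sqrt (\<rho> x)"
    have u: "0 \<le> u" "\<rho> x = u\<^sup>2" using nonneg[of x] by (auto simp: u_def)
    \<comment> \<open>Twice the gap in the desired bound, written in \<open>u\<close>, is this
      manifestly nonnegative quartic.\<close>
    have "0 \<le> (u - 1)\<^sup>2 * (u\<^sup>2 + 2 * u)" using u by simp
    also have "\<dots> = 2 * u - (2 + (u\<^sup>2 - 1) - (u\<^sup>2 - 1)\<^sup>2) "
      by (simp add: power2_eq_square algebra_simps)
    finally have "2 + (u\<^sup>2 - 1) - (u\<^sup>2 - 1)\<^sup>2 \<le> 2 * u" by (simp only: diff_ge_0_iff_ge)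
    then show ?thesis unfolding u(2) using u by (simp add: field_simps)
  qed
  have sqrt_int: "integrable M (\<lambda>x. sqrt (\<rho> x))"
    by (intro integrable_sqrt \<rho>(1) nonneg)
  have "1 - e / 2 \<le> expectation (\<lambda>x. 1 + (\<rho> x - 1) / 2 - (\<rho> x - 1)\<^sup>2 / 2)"
    using sq_le \<rho> sq by (simp add: prob_space)
  also have "\<dots> \<le> expectation (\<lambda>x. sqrt (\<rho> x))"
    using sqrt_int sq \<rho> pt by (intro integral_mono) auto
  finally show ?thesis .
qed

section \<open>Antisymmetric perturbations of C^1 densities\<close>

lemma nn_integral_ref_measure:
  assumes f: "f \<in> borel_measurable ref_measure"
  shows "(\<integral>\<^sup>+w. f w \<partial>ref_measure) =
    (\<integral>\<^sup>+x. (f (x, 1) + f (x, -1)) * indicator {0..1} x \<partial>lborel)"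
proof -
  interpret C: sigma_finite_measure "count_space {-1, 1::int}"
    by (rule sigma_finite_measure_count_space_countable) simp
  have "(\<integral>\<^sup>+w. f w \<partial>ref_measure) =
      (\<integral>\<^sup>+x. \<integral>\<^sup>+y. f (x, y) \<partial>count_space {-1, 1} \<partial>restrict_space lborel {0..1})"
    using f unfolding ref_measure_def by (rule C.nn_integral_fst[symmetric])
  also have "\<dots> = (\<integral>\<^sup>+x. (f (x, 1) + f (x, -1)) \<partial>restrict_space lborel {0..1})"
    by (intro nn_integral_cong) (simp add: nn_integral_count_space_finite add.commute)
  also have "\<dots> = (\<integral>\<^sup>+x. (f (x, 1) + f (x, -1)) * indicator {0..1} x \<partial>lborel)"
    by (rule nn_integral_restrict_space) simp
  finally show ?thesis .
qed

lemma partial1_has_derivative: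
  assumes "C1_Omega f" "x \<in> {0..1}" "y \<in> {-1, 1}"
  shows "((\<lambda>t. f (t, y)) has_real_derivative partial1 f (x, y)) (at x within {0..1})"
proof -
  have "(\<lambda>t. f (t, y)) differentiable (at x within {0..1})"
    using assms by (auto simp: C1_Omega_def Omega_def)
  then show ?thesis
    unfolding partial1_def has_real_derivative_iff_has_vector_derivative
    by (simp add: vector_derivative_works)
qed

lemma partial1_eqI:
  assumes "((\<lambda>t. f (t, y)) has_real_derivative d) (at x within {0..1})" "x \<in> {0..1}"
  shows "partial1 f (x, y) = d"
  using assms vector_derivative_within_closed_interval[of 0 1 x "\<lambda>t. f (t, y)" d]
  unfolding partial1_def has_real_derivative_iff_has_vector_derivative by simp

text \<open>Differentiation within \<open>{0..1}\<close> sees only points of \<open>Omega\<close>.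
  This is needed because the density selected by \<open>dens\<close> is pinned down only
  there.\<close>

lemma partial1_cong:
  assumes "C1_Omega f" "\<And>w. w \<in> Omega \<Longrightarrow> f w = g w" "w \<in> Omega"
  shows "partial1 g w = partial1 f w"
proof -
  obtain x y where w: "w = (x, y)" "x \<in> {0..1}" "y \<in> {-1, 1}"
    using assms(3) by (auto simp: Omega_def)
  have "((\<lambda>t. g (t, y)) has_real_derivative partial1 f (x, y)) (at x within {0..1})"
    by (rule has_field_derivative_transform_within[OF partial1_has_derivative[OF assms(1) w(2,3)] zero_less_one w(2)])
      (use assms(2) w in \<open>auto simp: Omega_def\<close>)
  then show ?thesis using partial1_eqI w by blast
qed

lemma odd_perturbation_C1:
  assumes f: "C1_Omega f" and k: "\<And>x. (k has_real_derivative k' x) (at x)"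
    and k': "continuous_on UNIV k'"
  defines "q \<equiv> \<lambda>(x, y). f (x, y) + of_int y * k x"
  shows "C1_Omega q"
    and "\<And>x y. x \<in> {0..1} \<Longrightarrow> y \<in> {-1, 1} \<Longrightarrow> partial1 q (x, y) = partial1 f (x, y) + of_int y * k' x"
proof -
  have der: "((\<lambda>t. q (t, y)) has_real_derivative partial1 f (x, y) + of_int y * k' x) (at x within {0..1})"
    if "x \<in> {0..1}" "y \<in> {-1, 1}" for x y
    unfolding q_def prod.case
    by (intro DERIV_add DERIV_cmult partial1_has_derivative f that has_field_derivative_at_within[OF k])
  then show eq: "\<And>x y. x \<in> {0..1} \<Longrightarrow> y \<in> {-1, 1} \<Longrightarrow> partial1 q (x, y) = partial1 f (x, y) + of_int y * k' x"
    using partial1_eqI by blast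
  have "continuous_on Omega (\<lambda>w. partial1 f w + of_int (snd w) * k' (fst w))"
    using f by (intro continuous_intros continuous_on_compose2[OF k'])
      (auto simp: C1_Omega_def)
  then have "continuous_on Omega (partial1 q)"
    by (rule continuous_on_cong[THEN iffD1, rotated 2]) (auto simp: Omega_def eq)
  moreover have "(\<lambda>t. q (t, y)) differentiable (at x within {0..1})" if "x \<in> {0..1}" "y \<in> {-1, 1}" for x y
    using der[OF that] by (intro differentiableI[OF has_field_derivative_imp_has_derivative])
  ultimately show "C1_Omega q"
    unfolding C1_Omega_def Omega_def by auto
qed

text \<open>The condition \<open>dom\<close> keeps both perturbed densities nonnegative. Since
  \<open>dens Q\<close> is an arbitrary choice among densities, the explicit formula must be
  transferred to it, which uniqueness of C^1 densities on \<open>Omega\<close> achieves.\<close>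

lemma odd_perturbation_in_calP_tilde:
  assumes P: "P \<in> calP_tilde" and k: "\<And>x. (k has_real_derivative k' x) (at x)"
    and k': "continuous_on UNIV k'"
    and dom: "\<forall>x\<in>{0..1}. \<forall>y\<in>{-1, 1}. \<bar>k x\<bar> \<le> dens P (x, y)"
  defines "Q \<equiv> density ref_measure (\<lambda>(x, y). ennreal (dens P (x, y) + of_int y * k x))"
  shows "Q \<in> calP_tilde"
    and "\<And>x y. x \<in> {0..1} \<Longrightarrow> y \<in> {-1, 1} \<Longrightarrow> dens Q (x, y) = dens P (x, y) + of_int y * k x"
    and "\<And>x y. x \<in> {0..1} \<Longrightarrow> y \<in> {-1, 1} \<Longrightarrow>
      partial1 (dens Q) (x, y) = partial1 (dens P) (x, y) + of_int y * k' x"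
proof -
  define q where "q = (\<lambda>(x, y). dens P (x, y) + of_int y * k x)"
  have P': "is_C1_density P (dens P)" by (rule is_C1_density_dens[OF P])
  then have C1: "C1_Omega (dens P)" by (simp add: is_C1_density_def)
  note q = odd_perturbation_C1[OF C1 k k', folded q_def]
  have nonneg: "0 \<le> q w" if "w \<in> Omega" for w
    using that dom by (auto simp: Omega_def q_def)
  have Q: "Q = density ref_measure (\<lambda>w. ennreal (q w))"
    unfolding Q_def q_def by (simp add: case_prod_unfold)
  have [measurable]: "q \<in> borel_measurable ref_measure" "dens P \<in> borel_measurable ref_measure"
    by (auto intro: C1_Omega_measurable q(1) C1)
  have "emeasure Q (space Q) = (\<integral>\<^sup>+w. ennreal (q w) \<partial>ref_measure)"
    unfolding Q by (simp add: emeasure_density cong: nn_integral_cong)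
  also have "\<dots> = (\<integral>\<^sup>+x. (ennreal (q (x, 1)) + ennreal (q (x, -1))) * indicator {0..1} x \<partial>lborel)"
    by (rule nn_integral_ref_measure) simp
  also have "\<dots> = (\<integral>\<^sup>+x. (ennreal (dens P (x, 1)) + ennreal (dens P (x, -1))) * indicator {0..1} x \<partial>lborel)"
  proof (rule nn_integral_cong)
    fix x :: real
    show "(ennreal (q (x, 1)) + ennreal (q (x, -1))) * indicator {0..1} x =
      (ennreal (dens P (x, 1)) + ennreal (dens P (x, -1))) * indicator {0..1} x"
    proof (cases "x \<in> {0..1}")
      case True
      have "0 \<le> dens P (x, 1)" "0 \<le> dens P (x, -1)"
        using True dom abs_ge_zero[of "k x"] by (blast intro: order_trans)+
      moreover have "0 \<le> q (x, 1)" "0 \<le> q (x, -1)"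
        using True by (auto intro!: nonneg simp: Omega_def)
      moreover have "q (x, 1) + q (x, -1) = dens P (x, 1) + dens P (x, -1)" by (simp add: q_def)
      ultimately show ?thesis by (simp flip: ennreal_plus)
    qed simp
  qed
  also have "\<dots> = (\<integral>\<^sup>+w. ennreal (dens P w) \<partial>ref_measure)"
    by (rule nn_integral_ref_measure[symmetric]) simp
  also have "\<dots> = emeasure P (space P)"
  proof -
    have "P = density ref_measure (\<lambda>w. ennreal (dens P w))" using P' by (simp add: is_C1_density_def)
    then have "emeasure P (space P) = emeasure (density ref_measure (\<lambda>w. ennreal (dens P w))) (space ref_measure)"
      by (metis space_density)
    then show ?thesis by (simp add: emeasure_density cong: nn_integral_cong)
  qed
  also have "\<dots> = 1"
    using P by (intro prob_space.emeasure_space_1) (simp add: calP_tilde_def)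
  finally have "prob_space Q" by (rule prob_spaceI)
  moreover have Q_dens: "is_C1_density Q q"
    using q(1) nonneg Q by (simp add: is_C1_density_def)
  moreover have "sets Q = sets Omega_borel"
    by (simp add: Q sets_ref_measure)
  ultimately show Q_in: "Q \<in> calP_tilde" by (auto simp: calP_tilde_def)
  have eq: "q w = dens Q w" if "w \<in> Omega" for w
    by (rule is_C1_density_unique[OF Q_dens is_C1_density_dens[OF Q_in] that])
  show "dens Q (x, y) = dens P (x, y) + of_int y * k x" if "x \<in> {0..1}" "y \<in> {-1, 1}" for x y
    using eq[of "(x, y)"] that by (auto simp: q_def Omega_def)
  show "partial1 (dens Q) (x, y) = partial1 (dens P) (x, y) + of_int y * k' x"
    if "x \<in> {0..1}" "y \<in> {-1, 1}" for x y
    using partial1_cong[OF q(1) eq, of "(x, y)"] q(2)[OF that] that by (auto simp: Omega_def)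
qed

text \<open>The \<open>P\<close>-integral of \<open>(\<rho> - 1)^2\<close> is that of
  \<open>k^2 / dens P\<close> over both labels and a window of length \<open>2 * w\<close>, hence at
  most \<open>4 * w * K^2 / m\<close>; the affinity loses at most half of it. The densities may
  vanish outside the window, so they are bounded below only on it.\<close>

lemma odd_perturbation_likelihood_ratio:
  assumes P: "P \<in> calP_tilde" and k: "\<And>x. (k has_real_derivative k' x) (at x)"
    and k': "continuous_on UNIV k'"
    and dom: "\<forall>x\<in>{0..1}. \<forall>y\<in>{-1, 1}. \<bar>k x\<bar> \<le> dens P (x, y)"
    and w: "0 < w" and supp: "\<And>x. w \<le> \<bar>x - a\<bar> \<Longrightarrow> k x = 0" and K: "\<And>x. \<bar>k x\<bar> \<le> K"
    and m: "0 < m" "\<And>x y. x \<in> {0..1} \<Longrightarrow> y \<in> {-1, 1} \<Longrightarrow> \<bar>x - a\<bar> \<le> w \<Longrightarrow> m \<le> dens P (x, y)"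
  obtains \<rho> where "\<rho> \<in> borel_measurable P" "\<And>v. (0::real) \<le> \<rho> v"
    "density ref_measure (\<lambda>(x, y). ennreal (dens P (x, y) + of_int y * k x)) =
      density P (\<lambda>v. ennreal (\<rho> v))"
    "1 - 2 * w * K\<^sup>2 / m \<le> (\<integral>v. sqrt (\<rho> v) \<partial>P)"
proof -
  let ?Q = "density ref_measure (\<lambda>(x, y). ennreal (dens P (x, y) + of_int y * k x))"
  \<comment> \<open>The truncation secures nonnegativity off \<open>Omega\<close>; on
    \<open>Omega\<close> it follows from \<open>dom\<close>. Where \<open>dens P v = 0\<close>,
    division by zero gives \<open>\<rho> v = 1\<close>, which is consistent because
    \<open>dom\<close> forces \<open>k\<close> to vanish there.\<close>
  define \<rho> where "\<rho> v = max 0 (1 + of_int (snd v) * k (fst v) / dens P v)" for v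
  have P': "is_C1_density P (dens P)" by (rule is_C1_density_dens[OF P])
  then have C1: "C1_Omega (dens P)" by (simp add: is_C1_density_def)
  have P_eq: "P = density ref_measure (\<lambda>v. ennreal (dens P v))"
    using P' by (simp add: is_C1_density_def)
  have sets_P: "sets P = sets ref_measure"
    using P by (simp add: calP_tilde_def sets_ref_measure)
  have [measurable]: "dens P \<in> borel_measurable ref_measure"
    by (rule C1_Omega_measurable[OF C1])
  have cont_k: "continuous_on UNIV k"
    using k by (intro continuous_at_imp_continuous_on ballI DERIV_isCont)
  have "(\<lambda>v. of_int (snd v) * k (fst v)) \<in> borel_measurable Omega_borel"
    unfolding Omega_borel_def
    by (intro borel_measurable_continuous_on_restrict continuous_intros
      continuous_on_compose2[OF cont_k]) auto
  then have [measurable]: "(\<lambda>v. of_int (snd v) * k (fst v)) \<in> borel_measurable ref_measure"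
    using measurable_cong_sets[OF sets_ref_measure refl] by blast
  have \<rho>_ref[measurable]: "\<rho> \<in> borel_measurable ref_measure"
    unfolding \<rho>_def[abs_def] by measurable
  then have \<rho>_meas: "\<rho> \<in> borel_measurable P"
    using measurable_cong_sets[OF sets_P refl] by blast
  have \<rho>_nonneg: "0 \<le> \<rho> v" for v by (simp add: \<rho>_def)
  have \<rho>_eq: "\<rho> v = 1 + of_int (snd v) * k (fst v) / dens P v" if "v \<in> Omega" for v
  proof -
    have "\<bar>of_int (snd v) * k (fst v)\<bar> \<le> dens P v"
      using that dom by (auto simp: Omega_def)
    then have "\<bar>of_int (snd v) * k (fst v) / dens P v\<bar> \<le> 1"
      by (simp add: abs_divide divide_le_eq_1) linarith
    then have "- 1 \<le> of_int (snd v) * k (fst v) / dens P v"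
      by (simp only: abs_le_iff) linarith
    then show ?thesis by (simp add: \<rho>_def)
  qed
  have Q_eq: "?Q = density P (\<lambda>v. ennreal (\<rho> v))"
  proof -
    have "density P (\<lambda>v. ennreal (\<rho> v)) = density ref_measure (\<lambda>v. ennreal (dens P v) * ennreal (\<rho> v))"
      by (subst P_eq, subst density_density_eq) auto
    also have "\<dots> = ?Q"
    proof (rule density_cong)
      show "AE v in ref_measure. ennreal (dens P v) * ennreal (\<rho> v) =
          (\<lambda>(x, y). ennreal (dens P (x, y) + of_int y * k x)) v"
      proof (rule AE_I2)
        fix v assume "v \<in> space ref_measure"
        then have v: "v \<in> Omega" by (simp add: space_ref_measure)
        then have le: "\<bar>k (fst v)\<bar> \<le> dens P v"
          using dom by (auto simp: Omega_def)
        then have "dens P v * \<rho> v = dens P v + of_int (snd v) * k (fst v)"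
          by (cases "dens P v = 0") (auto simp: \<rho>_eq[OF v] field_simps)
        then show "ennreal (dens P v) * ennreal (\<rho> v) =
          (\<lambda>(x, y). ennreal (dens P (x, y) + of_int y * k x)) v"
          using le \<rho>_nonneg[of v] by (simp add: case_prod_unfold ennreal_mult[symmetric])
      qed
    qed (auto simp: case_prod_unfold)
    finally show ?thesis by simp
  qed
  interpret P: prob_space P using P by (simp add: calP_tilde_def)
  have "prob_space ?Q"
    using odd_perturbation_in_calP_tilde(1)[OF P k k' dom] by (simp add: calP_tilde_def)
  then have one: "(\<integral>\<^sup>+v. ennreal (\<rho> v) \<partial>P) = 1"
    using prob_space.emeasure_space_1[of ?Q] \<rho>_meas unfolding Q_eq
    by (simp add: emeasure_density cong: nn_integral_cong)
  have K0: "0 \<le> K" using K[of 0] by linarith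
  have "(\<integral>\<^sup>+v. ennreal ((\<rho> v - 1)\<^sup>2) \<partial>P) =
      (\<integral>\<^sup>+v. ennreal (dens P v) * ennreal ((\<rho> v - 1)\<^sup>2) \<partial>ref_measure)"
    by (subst P_eq, subst nn_integral_density) auto
  also have "\<dots> = (\<integral>\<^sup>+x. (ennreal (dens P (x, 1)) * ennreal ((\<rho> (x, 1) - 1)\<^sup>2) +
      ennreal (dens P (x, -1)) * ennreal ((\<rho> (x, -1) - 1)\<^sup>2)) * indicator {0..1} x \<partial>lborel)"
    by (rule nn_integral_ref_measure) simp
  also have "\<dots> \<le> (\<integral>\<^sup>+x. ennreal (2 * K\<^sup>2 / m) * indicator {a - w..a + w} x \<partial>lborel)"
  proof (rule nn_integral_mono)
    fix x :: real
    have le: "dens P (x, y) * (\<rho> (x, y) - 1)\<^sup>2 \<le> K\<^sup>2 / m" if x: "x \<in> {0..1}" "\<bar>x - a\<bar> \<le> w" and y: "y \<in> {-1, 1}" for y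
    proof -
      have f: "m \<le> dens P (x, y)" using m x y by auto
      have "(\<rho> (x, y) - 1)\<^sup>2 = (k x)\<^sup>2 / (dens P (x, y))\<^sup>2"
        using x y by (auto simp: \<rho>_eq Omega_def power_divide)
      then have "dens P (x, y) * (\<rho> (x, y) - 1)\<^sup>2 = (k x)\<^sup>2 / dens P (x, y)"
        using f m by (simp add: power2_eq_square)
      also have "\<dots> \<le> K\<^sup>2 / m"
        using f m K0 K[of x] by (intro frac_le) (auto simp: abs_le_square_iff[symmetric])
      finally show ?thesis .
    qed
    show "(ennreal (dens P (x, 1)) * ennreal ((\<rho> (x, 1) - 1)\<^sup>2) +
        ennreal (dens P (x, -1)) * ennreal ((\<rho> (x, -1) - 1)\<^sup>2)) * indicator {0..1} x
        \<le> ennreal (2 * K\<^sup>2 / m) * indicator {a - w..a + w} x"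
    proof (cases "x \<in> {0..1}")
      case x: True
      have nn: "0 \<le> dens P (x, 1)" "0 \<le> dens P (x, -1)"
        using x dom abs_ge_zero[of "k x"] by (blast intro: order_trans)+
      show ?thesis
      proof (cases "\<bar>x - a\<bar> \<le> w")
        case True
        then have "x \<in> {a - w..a + w}" by (auto simp: abs_le_iff)
        moreover have "dens P (x, 1) * (\<rho> (x, 1) - 1)\<^sup>2 + dens P (x, -1) * (\<rho> (x, -1) - 1)\<^sup>2 \<le> 2 * K\<^sup>2 / m"
          using le[OF x True, of 1] le[OF x True, of "-1"] by simp
        ultimately show ?thesis
          using x nn by (simp add: ennreal_mult[symmetric] ennreal_plus[symmetric] ennreal_leI del: ennreal_plus)
      next
        case False
        then have "k x = 0" by (intro supp) simp
        then have "\<rho> (x, 1) = 1" "\<rho> (x, -1) = 1" by (simp_all add: \<rho>_def)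
        then show ?thesis by simp
      qed
    qed simp
  qed
  also have "\<dots> = ennreal (4 * w * K\<^sup>2 / m)"
    using w m by (subst nn_integral_cmult_indicator) (simp_all add: ennreal_mult[symmetric] field_simps)
  finally have "(\<integral>\<^sup>+v. ennreal ((\<rho> v - 1)\<^sup>2) \<partial>P) \<le> ennreal (4 * w * K\<^sup>2 / m)" .
  from P.expectation_sqrt_ge[OF \<rho>_meas \<rho>_nonneg one this] w m
  have "1 - 2 * w * K\<^sup>2 / m \<le> (\<integral>v. sqrt (\<rho> v) \<partial>P)" by simp
  with \<rho>_meas \<rho>_nonneg Q_eq show thesis by (rule that)
qed

section \<open>The crossing point\<close>

lemma crossing_eqI:
  assumes "b \<in> {0..1}" "dens P (b, 1) = dens P (b, -1)"
    and "\<And>x. x \<in> {0..1} \<Longrightarrow> dens P (x, 1) = dens P (x, -1) \<Longrightarrow> x = b"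
  shows "crossing P = b"
  unfolding crossing_def using assms by (intro the_equality) blast+

lemma calP_D:
  assumes "P \<in> calP"
  shows "P \<in> calP_tilde" "0 < crossing P" "crossing P < 1"
    and "dens P (crossing P, 1) = dens P (crossing P, -1)"
    and "\<And>x. x \<in> {0..1} \<Longrightarrow> dens P (x, 1) = dens P (x, -1) \<Longrightarrow> x = crossing P"
    and "partial1 (dens P) (crossing P, -1) < partial1 (dens P) (crossing P, 1)"
proof -
  have ex: "\<exists>!x. x \<in> {0..1} \<and> dens P (x, 1) = dens P (x, -1)"
    using assms by (simp add: calP_def)
  then show "dens P (crossing P, 1) = dens P (crossing P, -1)"
    using theI'[OF ex] unfolding crossing_def by blast
  show "x = crossing P" if "x \<in> {0..1}" "dens P (x, 1) = dens P (x, -1)" for x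
    unfolding crossing_def using the1_equality[OF ex, of x] that by blast
qed (use assms in \<open>simp_all add: calP_def\<close>)

lemma calP_I:
  assumes "P \<in> calP_tilde" "0 < b" "b < 1" "dens P (b, 1) = dens P (b, -1)"
    and "\<And>x. x \<in> {0..1} \<Longrightarrow> dens P (x, 1) = dens P (x, -1) \<Longrightarrow> x = b"
    and "partial1 (dens P) (b, -1) < partial1 (dens P) (b, 1)"
  shows "P \<in> calP"
proof -
  have "crossing P = b"
    using assms(2,3) by (intro crossing_eqI assms(4,5)) simp
  moreover have "\<exists>!x. x \<in> {0..1} \<and> dens P (x, 1) = dens P (x, -1)"
    using assms(2,3) by (intro ex1I[of _ b] conjI assms(4,5)) auto
  ultimately show ?thesis using assms(1-3,6) by (simp add: calP_def)
qed

text \<open>If the common value were \<open>0\<close>, both densities would have a minimum there, so that both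
  derivatives would vanish.\<close>

lemma dens_crossing_pos:
  assumes "P \<in> calP"
  shows "0 < dens P (crossing P, 1)"
proof (rule ccontr)
  let ?a = "crossing P"
  note P = calP_D[OF assms]
  have C1: "C1_Omega (dens P)" and nonneg: "\<And>w. w \<in> Omega \<Longrightarrow> 0 \<le> dens P w"
    using is_C1_density_dens[OF P(1)] by (auto simp: is_C1_density_def)
  assume "\<not> 0 < dens P (?a, 1)"
  then have zero: "dens P (?a, y) = 0" if "y \<in> {-1, 1}" for y
    using nonneg[of "(?a, 1)"] P that by (auto simp: Omega_def)
  have "partial1 (dens P) (?a, y) = 0" if y: "y \<in> {-1, 1}" for y
  proof (rule DERIV_local_min)
    have "((\<lambda>t. dens P (t, y)) has_real_derivative partial1 (dens P) (?a, y)) (at ?a within {0<..<1})"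
      by (rule DERIV_subset[OF partial1_has_derivative[OF C1 _ y]]) (use P in auto)
    then show "((\<lambda>t. dens P (t, y)) has_real_derivative partial1 (dens P) (?a, y)) (at ?a)"
      using at_within_open[of ?a "{0<..<1}"] P by simp
    show "0 < min ?a (1 - ?a)" using P by simp
    show "\<forall>x. \<bar>?a - x\<bar> < min ?a (1 - ?a) \<longrightarrow> dens P (?a, y) \<le> dens P (x, y)"
      using zero[OF y] nonneg y by (auto simp: Omega_def abs_less_iff)
  qed
  then show False using P by simp
qed

lemma eventually_nhds_between:
  fixes h :: "real \<Rightarrow> real"
  assumes "continuous_on {0..1} h" "0 < a" "a < 1" "l < h a" "h a < u"
  shows "\<forall>\<^sub>F x in nhds a. l < h x \<and> h x < u"
proof -
  have "isCont h a"
    using assms continuous_on_interior[of "{0..1}" h a] by simp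
  then have "(h \<longlongrightarrow> h a) (nhds a)"
    by (simp add: isCont_def tendsto_at_iff_tendsto_nhds)
  then show ?thesis
    using assms(4,5) by (intro eventually_conj order_tendstoD)
qed

section \<open>Alternatives inside an open set\<close>

text \<open>The crossing moves linearly in \<open>w\<close> while the affinity drops only by a
  multiple of \<open>w^3\<close>; this mismatch produces the cube root in the rate. The constants
  serve all small \<open>w\<close> at once.\<close>

lemma perturbation_in_open:
  assumes U: "openin calP_topology U" and P: "P \<in> U"
  obtains \<kappa> C w0 where "0 < \<kappa>" "0 < C" "0 < w0"
    "\<And>w. 0 < w \<Longrightarrow> w \<le> w0 \<Longrightarrow> \<exists>Q\<in>U. \<exists>\<rho>. \<rho> \<in> borel_measurable P \<and> (\<forall>v. (0::real) \<le> \<rho> v) \<and>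
      Q = density P (\<lambda>v. ennreal (\<rho> v)) \<and> 1 - C * w ^ 3 \<le> (\<integral>v. sqrt (\<rho> v) \<partial>P) \<and>
      \<kappa> * w < \<bar>crossing P - crossing Q\<bar>"
proof -
  interpret D: Metric_space calP_tilde dist_P by (rule Metric_space_dist_P)
  obtain V where V: "openin D.mtopology V" "U = V \<inter> calP"
    using U unfolding calP_topology_def openin_subtopology by auto
  then obtain r where r: "0 < r" "D.mball P r \<subseteq> V"
    using P by (auto simp: D.openin_mtopology)
  define a where "a = crossing P"
  have "P \<in> calP" using P V by simp
  note P = calP_D[OF this, folded a_def] and f_pos = dens_crossing_pos[OF this, folded a_def]
  have C1: "C1_Omega (dens P)" using is_C1_density_dens[OF P(1)] by (simp add: is_C1_density_def)
  define g where "g x = dens P (x, 1) - dens P (x, -1)" for x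
  define g' where "g' x = partial1 (dens P) (x, 1) - partial1 (dens P) (x, -1)" for x
  define s where "s = g' a"
  \<comment> \<open>Half the common value at the crossing, so that by continuity it bounds both
    densities from below nearby.\<close>
  define m where "m = dens P (a, 1) / 2"
  have s: "0 < s" using P by (simp add: s_def g'_def)
  have m: "0 < m" using f_pos by (simp add: m_def)
  have der_g: "(g has_real_derivative g' x) (at x within {0..1})" if "x \<in> {0..1}" for x
    unfolding g_def[abs_def] g'_def
    by (intro DERIV_diff partial1_has_derivative[OF C1 that]) auto
  have cont_p: "continuous_on {0..1} (\<lambda>x. partial1 (dens P) (x, y))" if "y \<in> {-1, 1}" for y
    by (rule continuous_on_compose2[OF calP_tilde_continuous(2)[OF P(1)]])
      (use that in \<open>auto simp: Omega_def intro!: continuous_intros\<close>)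
  have "\<forall>\<^sub>F x in nhds a. s / 2 < g' x \<and> g' x < 2 * s"
    unfolding g'_def using P s by (intro eventually_nhds_between continuous_on_diff cont_p)
      (auto simp: s_def g'_def)
  moreover have "\<forall>\<^sub>F x in nhds a. m < dens P (x, y) \<and> dens P (x, y) < 3 * m" if "y \<in> {-1, 1}" for y
    using P f_pos that
    by (intro eventually_nhds_between C1_Omega_continuous_slice[OF C1]) (auto simp: m_def)
  moreover have "\<forall>\<^sub>F x in nhds a. x \<in> {0<..<1}"
    using P by (intro eventually_nhds_in_open) auto
  ultimately have "\<forall>\<^sub>F x in nhds a. s / 2 < g' x \<and> g' x < 2 * s \<and> m < dens P (x, 1) \<and>
      m < dens P (x, -1) \<and> x \<in> {0<..<1}"
    by (auto simp: eventually_conj_iff)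
  then obtain d where d: "0 < d" and near: "\<And>x. \<bar>x - a\<bar> < d \<Longrightarrow> s / 2 < g' x \<and> g' x < 2 * s \<and>
      m < dens P (x, 1) \<and> m < dens P (x, -1) \<and> x \<in> {0<..<1}"
    unfolding eventually_nhds_metric dist_real_def by blast
  \<comment> \<open>The amplitude of the bump. The C^1-distance will be at most
    \<open>l * w + 4 * l\<close>, below \<open>r\<close> once \<open>w \<le> 1\<close>, and slopes
    up to \<open>4 * l \<le> s / 8\<close> cannot spoil the strict inequality of
    derivatives.\<close>
  define l where "l = min (r / 10) (s / 32)"
  have l: "0 < l" "5 * l < r" "4 * l \<le> s / 8" using r s by (auto simp: l_def)
  define \<kappa> where "\<kappa> = min (1 / 2) (l / (2 * s))"
  have \<kappa>: "0 < \<kappa>" "\<kappa> \<le> 1 / 2" using l s by (auto simp: \<kappa>_def)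
  have \<kappa>l: "2 * s * \<kappa> \<le> l"
  proof -
    have "\<kappa> \<le> l / (2 * s)" by (simp add: \<kappa>_def)
    then show ?thesis using s by (simp add: field_simps)
  qed
  \<comment> \<open>The three bounds keep the window inside the neighbourhood just found, the
    perturbed measure inside the ball, and the bump below the densities
    (\<open>l * w \<le> m\<close>).\<close>
  define w0 where "w0 = min (d / 2) (min 1 (m / l))"
  show thesis
  proof (rule that)
    show "0 < \<kappa>" by fact
    show "0 < 2 * l\<^sup>2 / m" using l m by simp
    show "0 < w0" using d l m by (simp add: w0_def)
    fix w assume w: "0 < w" "w \<le> w0"
    have w1: "w < d" "w \<le> 1" "l * w \<le> m"
      using w d l by (auto simp: w0_def field_simps)
    define k where "k x = l * bump a w x" for x
    define k' where "k' x = l * bump_deriv a w x" for x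
    have k: "(k has_real_derivative k' x) (at x)" for x
      unfolding k_def[abs_def] k'_def by (rule DERIV_cmult[OF bump_has_derivative])
    have cont_k': "continuous_on UNIV k'"
      unfolding k'_def[abs_def] using w by (intro continuous_intros continuous_on_bump_deriv)
    have k'_le: "\<bar>k' x\<bar> \<le> 4 * l" for x
      using mult_left_mono[OF abs_bump_deriv_le[OF w(1)], of l a x] l by (simp add: k'_def abs_mult)
    have k_le: "\<bar>k x\<bar> \<le> l * w" for x
      using bump_le[OF w(1)] bump_nonneg[OF w(1)] l by (simp add: k_def abs_mult)
    have k_0: "k x = 0" if "w \<le> \<bar>x - a\<bar>" for x
      using bump_eq_0[OF w(1) that] by (simp add: k_def)
    have k_ge: "l * w / 2 \<le> k x" if "\<bar>x - a\<bar> \<le> w / 2" for x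
      using mult_left_mono[OF bump_ge[OF w(1) that], of l] l by (simp add: k_def)
    have f_ge: "m \<le> dens P (x, y)" if "x \<in> {0..1}" "y \<in> {-1, 1}" "\<bar>x - a\<bar> \<le> w" for x y
      using near[of x] that w1 by auto
    have dom: "\<forall>x\<in>{0..1}. \<forall>y\<in>{-1, 1}. \<bar>k x\<bar> \<le> dens P (x, y)"
    proof (intro ballI)
      fix x :: real and y :: int assume that: "x \<in> {0..1}" "y \<in> {-1, 1}"
      show "\<bar>k x\<bar> \<le> dens P (x, y)"
    proof (cases "\<bar>x - a\<bar> \<le> w")
      case True
      then show ?thesis using f_ge[OF that True] k_le[of x] w1 by linarith
    next
      case False
      then show ?thesis
        using k_0[of x] that is_C1_density_dens[OF P(1)] by (auto simp: is_C1_density_def Omega_def)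
    qed
    qed
    define Q where "Q = density ref_measure (\<lambda>(x, y). ennreal (dens P (x, y) + of_int y * k x))"
    note Q = odd_perturbation_in_calP_tilde[OF P(1) k cont_k' dom, folded Q_def]
    obtain \<rho> where \<rho>: "\<rho> \<in> borel_measurable P" "\<And>v. (0::real) \<le> \<rho> v"
        "Q = density P (\<lambda>v. ennreal (\<rho> v))" "1 - 2 * w * (l * w)\<^sup>2 / m \<le> (\<integral>v. sqrt (\<rho> v) \<partial>P)"
      by (rule odd_perturbation_likelihood_ratio[where a = a, OF P(1) k cont_k' dom w(1) k_0 k_le m f_ge,
            folded Q_def]) (assumption | rule that)+
    have sub: "{a - w..a + w} \<subseteq> {0<..<1}"
    proof
      fix x assume "x \<in> {a - w..a + w}"
      then have "\<bar>x - a\<bar> < d" using w1 by auto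
      then show "x \<in> {0<..<1}" using near by blast
    qed
    obtain b where b: "a - w < b" "b < a - \<kappa> * w" "g b + 2 * k b = 0"
        "\<And>x. x \<in> {0..1} \<Longrightarrow> g x + 2 * k x = 0 \<Longrightarrow> x = b"
    proof (rule perturbed_zero[OF w(1) sub der_g _ _ _ k _ k_0 k_ge \<kappa> \<kappa>l])
      show "s / 2 < g' x \<and> g' x < 2 * s" if "\<bar>x - a\<bar> \<le> w" for x
        using near[of x] that w1 by auto
      show "g a = 0" using P by (simp add: g_def)
      show "x = a" if "x \<in> {0..1}" "g x = 0" for x
        using P(5)[of x] that by (simp add: g_def)
      show "\<bar>k' x\<bar> \<le> s / 8" for x using k'_le[of x] l by linarith
    qed (assumption | rule that)+
    have b_near: "\<bar>b - a\<bar> < d" using b w1 mult_pos_pos[OF \<kappa>(1) w(1)] by auto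
    have b01: "0 < b" "b < 1" using near[OF b_near] by auto
    have Q_diff: "dens Q (x, 1) - dens Q (x, -1) = g x + 2 * k x" if "x \<in> {0..1}" for x
      using Q(2)[of x 1] Q(2)[of x "-1"] that by (simp add: g_def)
    have Q_eq: "dens Q (b, 1) = dens Q (b, -1)"
      using Q_diff[of b] b01 b by simp
    have Q_uniq: "x = b" if "x \<in> {0..1}" "dens Q (x, 1) = dens Q (x, -1)" for x
      using Q_diff[of x] that by (intro b) auto
    have "partial1 (dens Q) (b, -1) < partial1 (dens Q) (b, 1)"
    proof -
      have "partial1 (dens Q) (b, 1) - partial1 (dens Q) (b, -1) = g' b + 2 * k' b"
        using Q(3)[of b 1] Q(3)[of b "-1"] b01 by (simp add: g'_def)
      then show ?thesis using near[OF b_near] k'_le[of b] l s by (auto simp: abs_le_iff)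
    qed
    then have "Q \<in> calP" by (intro calP_I[OF Q(1) b01 Q_eq Q_uniq])
    moreover have "crossing Q = b" using b01 by (intro crossing_eqI Q_eq Q_uniq) simp
    then have "\<kappa> * w < \<bar>crossing P - crossing Q\<bar>" using b by (simp add: a_def)
    moreover have "Q \<in> V"
    proof -
      have "(SUP v\<in>Omega. \<bar>dens P v - dens Q v\<bar>) \<le> l * w"
      proof (rule cSUP_least)
        fix v assume "v \<in> Omega"
        then show "\<bar>dens P v - dens Q v\<bar> \<le> l * w"
          using Q(2)[of "fst v" "snd v"] k_le[of "fst v"] by (auto simp: Omega_def)
      qed (simp add: Omega_def)
      moreover have "(SUP v\<in>Omega. \<bar>partial1 (dens P) v - partial1 (dens Q) v\<bar>) \<le> 4 * l"
      proof (rule cSUP_least)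
        fix v assume "v \<in> Omega"
        then show "\<bar>partial1 (dens P) v - partial1 (dens Q) v\<bar> \<le> 4 * l"
          using Q(3)[of "fst v" "snd v"] k'_le[of "fst v"] by (auto simp: Omega_def)
      qed (simp add: Omega_def)
      moreover have "l * w \<le> l" using l w1 by simp
      ultimately have "dist_P P Q < r" using l(2) unfolding dist_P_def
        by (simp only: P(1) Q(1) simp_thms if_True)
      then show ?thesis using r P(1) Q(1) by (auto simp: D.in_mball)
    qed
    moreover have "1 - 2 * l\<^sup>2 / m * w ^ 3 \<le> (\<integral>v. sqrt (\<rho> v) \<partial>P)"
      using \<rho>(4) by (simp add: power2_eq_square power3_eq_cube algebra_simps)
    ultimately show "\<exists>Q\<in>U. \<exists>\<rho>. \<rho> \<in> borel_measurable P \<and> (\<forall>v. (0::real) \<le> \<rho> v) \<and>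
      Q = density P (\<lambda>v. ennreal (\<rho> v)) \<and> 1 - 2 * l\<^sup>2 / m * w ^ 3 \<le> (\<integral>v. sqrt (\<rho> v) \<partial>P) \<and>
      \<kappa> * w < \<bar>crossing P - crossing Q\<bar>"
      using \<rho> V by blast
  qed
qed

section \<open>Numerical bounds and the conclusion\<close>

text \<open>The left side is the squared affinity that Le Cam's inequality requires for
  \<open>\<theta> = 2 * \<delta>\<close>. It is at most \<open>4 * \<delta>\<close>, and while the
  logarithm is nonpositive the slack between 4 and 11 pays for the factor
  \<open>exp (- 1 / 12)\<close>. For larger \<open>\<delta>\<close> the absolute value grows again,
  but a comparison of \<open>3 / 4\<close> with \<open>1 - 11 / 48 = 37 / 48\<close>
  suffices.\<close>

lemma exp_ge_testing_level:
  fixes \<delta> :: real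
  assumes \<delta>: "0 < \<delta>" "\<delta> \<le> 1 / 4"
  shows "2 * \<delta> * (2 - 2 * \<delta>) \<le> exp (- (\<bar>ln (11 * \<delta>)\<bar> + 1) / 12)"
proof (cases "11 * \<delta> \<le> 1")
  case True
  have "2 * \<delta> * (2 - 2 * \<delta>) \<le> 4 * \<delta>" using \<delta> by (simp add: algebra_simps)
  also have "\<dots> \<le> 11 * \<delta> * (1 - 1 / 12)" using \<delta> by simp
  also have "\<dots> \<le> 11 * \<delta> * exp (- 1 / 12)"
    using exp_ge_add_one_self[of "- 1 / 12"] \<delta> by (intro mult_left_mono) auto
  also have "\<dots> = exp (ln (11 * \<delta>) + - 1 / 12)" using \<delta> by (subst exp_add) simp
  also have "\<dots> \<le> exp (- (\<bar>ln (11 * \<delta>)\<bar> + 1) / 12)"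
    using True \<delta> by simp
  finally show ?thesis .
next
  case False
  then have "\<bar>ln (11 * \<delta>)\<bar> \<le> 11 * \<delta> - 1"
    using ln_le_minus_one[of "11 * \<delta>"] \<delta> by simp
  moreover have "1 - (11 / 4) / 12 \<le> 1 + (- (u + 1) / 12)" if "u \<le> 11 * \<delta> - 1" for u
    using that \<delta> by (simp add: field_simps)
  ultimately have "1 - (11 / 4) / 12 \<le> 1 + (- (\<bar>ln (11 * \<delta>)\<bar> + 1) / 12)" by blast
  also have "\<dots> \<le> exp (- (\<bar>ln (11 * \<delta>)\<bar> + 1) / 12)" by (rule exp_ge_add_one_self)
  finally have "1 - (11 / 4) / 12 \<le> exp (- (\<bar>ln (11 * \<delta>)\<bar> + 1) / 12)" .
  moreover have "2 * \<delta> * (2 - 2 * \<delta>) \<le> 3 / 4"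
  proof -
    \<comment> \<open>Four times this product is \<open>3 / 4\<close> minus the left side of the
      claim.\<close>
    have "0 \<le> (1 / 4 - \<delta>) * (3 / 4 - \<delta>)" using \<delta> by (intro mult_nonneg_nonneg) auto
    then show ?thesis by (simp add: field_simps)
  qed
  ultimately show ?thesis by simp
qed

text \<open>It comes down to \<open>x * (1 - 2 * x) \<ge> 0\<close>. The bound turns powers of
  \<open>1 - C * w^3\<close> into exponentials, at the price of requiring \<open>n\<close> large
  enough for \<open>C * w^3 \<le> 1 / 2\<close>.\<close>

lemma exp_le_one_minus:
  fixes x :: real
  assumes "0 \<le> x" "x \<le> 1 / 2"
  shows "exp (- 2 * x) \<le> 1 - x"
proof -
  have "1 \<le> (1 - x) * (1 + 2 * x)" using mult_nonneg_nonneg[of x "1 - 2 * x"] assms by (simp add: algebra_simps)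
  also have "\<dots> \<le> (1 - x) * exp (2 * x)"
    using assms exp_ge_add_one_self[of "2 * x"] by (intro mult_left_mono) auto
  finally show ?thesis by (simp add: exp_minus field_simps)
qed

theorem theorem1p1:
  fixes U :: "(real \<times> int) measure set"
  assumes "openin calP_topology U" and "U \<noteq> {}"
  shows "\<exists>c1 :: real. c1 > 0 \<and>
    (\<forall>\<delta> :: real. 0 < \<delta> \<and> \<delta> \<le> 1/4 \<longrightarrow>
      (\<forall>a_hat :: nat \<Rightarrow> (nat \<Rightarrow> real \<times> int) \<Rightarrow> real.
        (\<forall>n. a_hat n \<in> borel_measurable (\<Pi>\<^sub>M i\<in>{..<n}. Omega_borel)) \<longrightarrow>
        liminf (\<lambda>n. SUP P\<in>U.
          emeasure (\<Pi>\<^sub>M i\<in>{..<n}. P)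
            {\<omega> \<in> space (\<Pi>\<^sub>M i\<in>{..<n}. P).
              real n powr (1/3) * \<bar>a_hat n \<omega> - crossing P\<bar>
                > c1 * \<bar>ln (11 * \<delta>)\<bar> powr (1/3)})
        \<ge> ennreal \<delta>))"
proof -
  obtain P where P: "P \<in> U" using assms by blast
  obtain \<kappa> C w0 where pos: "0 < \<kappa>" "0 < C" "0 < w0"
    and pert: "\<And>w. 0 < w \<Longrightarrow> w \<le> w0 \<Longrightarrow> \<exists>Q\<in>U. \<exists>\<rho>. \<rho> \<in> borel_measurable P \<and> (\<forall>v. (0::real) \<le> \<rho> v) \<and>
      Q = density P (\<lambda>v. ennreal (\<rho> v)) \<and> 1 - C * w ^ 3 \<le> (\<integral>v. sqrt (\<rho> v) \<partial>P) \<and>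
      \<kappa> * w < \<bar>crossing P - crossing Q\<bar>"
    using perturbation_in_open[OF assms(1) P] by metis
  have U_tilde: "U \<subseteq> calP_tilde"
    using openin_subset[OF assms(1)] unfolding calP_topology_def topspace_subtopology calP_def by auto
  \<comment> \<open>Here \<open>4 * C * D^3 = 1 / 12\<close>, so that \<open>2 * n\<close> factors
    \<open>exp (- 2 * (C * w^3))\<close> multiply to exactly
    \<open>exp (- (L + 1) / 12)\<close>.\<close>
  define D where "D = (1 / (48 * C)) powr (1 / 3)"
  have D: "0 < D" "D ^ 3 = 1 / (48 * C)"
    using pos by (auto simp: D_def powr_power)
  \<comment> \<open>The half comes from the triangle inequality: an estimate within the rescaled
    tolerance \<open>T\<close> of both crossings would put them within
    \<open>2 * T = \<kappa> * D * L powr (1/3)\<close>, less than their separation.\<close>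
  define c1 where "c1 = \<kappa> * D / 2"
  show ?thesis
  proof (intro exI[of _ c1] conjI allI impI, goal_cases)
    case 1
    show "0 < c1" using pos D by (simp add: c1_def)
  next
    case (2 \<delta> a_hat)
    then have \<delta>: "0 < \<delta>" "\<delta> \<le> 1 / 4" by auto
    have a_hat[measurable]: "a_hat n \<in> borel_measurable (\<Pi>\<^sub>M i\<in>{..<n}. Omega_borel)" for n
      using 2 by blast
    define L where "L = \<bar>ln (11 * \<delta>)\<bar>"
    define T where "T = c1 * L powr (1 / 3)"
    \<comment> \<open>With \<open>L\<close> alone the width would be zero at
      \<open>\<delta> = 1 / 11\<close>; \<open>L + 1\<close> keeps it positive and only increases
      the separation.\<close>
    define w where "w n = D * ((L + 1) / real n) powr (1 / 3)" for n
    define E where "E n P = {\<omega> \<in> space (\<Pi>\<^sub>M i\<in>{..<n}. P).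
      real n powr (1/3) * \<bar>a_hat n \<omega> - crossing P\<bar> > T}" for n P
    have L: "0 \<le> L" by (simp add: L_def)
    have E_sets: "E n Q \<in> sets (\<Pi>\<^sub>M i\<in>{..<n}. Q)" if "Q \<in> U" for n Q
    proof -
      have "sets Q = sets Omega_borel" using that U_tilde by (auto simp: calP_tilde_def)
      then have "sets (\<Pi>\<^sub>M i\<in>{..<n}. Q) = sets (\<Pi>\<^sub>M i\<in>{..<n}. Omega_borel)"
        by (intro sets_PiM_cong) auto
      then have [measurable]: "a_hat n \<in> borel_measurable (\<Pi>\<^sub>M i\<in>{..<n}. Q)"
        using a_hat measurable_cong_sets by blast
      show ?thesis unfolding E_def by measurable
    qed
    have "w \<longlonglongrightarrow> D * 0"
      unfolding w_def[abs_def] using L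
      by (intro tendsto_mult tendsto_const tendsto_zero_powrI[OF lim_const_over_n]) auto
    then have "\<forall>\<^sub>F n in sequentially. w n < w0"
      using pos by (intro order_tendstoD) auto
    moreover have "(\<lambda>n. C * D ^ 3 * (L + 1) / real n) \<longlonglongrightarrow> 0"
      by (rule lim_const_over_n)
    then have "\<forall>\<^sub>F n in sequentially. C * D ^ 3 * (L + 1) / real n < 1 / 2"
      by (intro order_tendstoD) auto
    ultimately have "\<forall>\<^sub>F n in sequentially. ennreal \<delta> \<le> (SUP P\<in>U. emeasure (\<Pi>\<^sub>M i\<in>{..<n}. P) (E n P))"
      using eventually_gt_at_top[of 0]
    proof eventually_elim
      case (elim n)
      have n: "0 < real n" using elim by simp
      have w_pos: "0 < w n" using D L n by (simp add: w_def)
      have w3: "w n ^ 3 = D ^ 3 * (L + 1) / real n"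
        using L n by (simp add: w_def power_mult_distrib powr_power)
      have Cw: "0 \<le> C * w n ^ 3" "C * w n ^ 3 < 1 / 2"
        using elim(2) pos w_pos by (simp, simp add: w3 mult.assoc)
      obtain Q \<rho> where Q: "Q \<in> U" and \<rho>: "\<rho> \<in> borel_measurable P" "\<And>v. (0::real) \<le> \<rho> v"
          "Q = density P (\<lambda>v. ennreal (\<rho> v))" "1 - C * w n ^ 3 \<le> (\<integral>v. sqrt (\<rho> v) \<partial>P)"
          "\<kappa> * w n < \<bar>crossing P - crossing Q\<bar>"
        using pert[OF w_pos less_imp_le[OF elim(1)]] by blast
      have sets_eq: "sets (\<Pi>\<^sub>M i\<in>{..<n}. Q) = sets (\<Pi>\<^sub>M i\<in>{..<n}. P)"
        by (intro sets_PiM_cong) (auto simp: \<rho>(3))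
      have space_eq: "space (\<Pi>\<^sub>M i\<in>{..<n}. Q) = space (\<Pi>\<^sub>M i\<in>{..<n}. P)"
        using sets_eq by (rule sets_eq_imp_space_eq)
      have cover: "space (\<Pi>\<^sub>M i\<in>{..<n}. P) \<subseteq> E n P \<union> E n Q"
      proof (rule subsetI, rule ccontr)
        fix \<omega> assume \<omega>: "\<omega> \<in> space (\<Pi>\<^sub>M i\<in>{..<n}. P)" "\<omega> \<notin> E n P \<union> E n Q"
        then have "real n powr (1/3) * \<bar>a_hat n \<omega> - crossing P\<bar> \<le> T"
            "real n powr (1/3) * \<bar>a_hat n \<omega> - crossing Q\<bar> \<le> T"
          by (auto simp: E_def space_eq)
        then have "real n powr (1/3) * (\<bar>a_hat n \<omega> - crossing P\<bar> + \<bar>a_hat n \<omega> - crossing Q\<bar>) \<le> 2 * T"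
          by (simp add: distrib_left)
        moreover have "real n powr (1/3) * \<bar>crossing P - crossing Q\<bar> \<le>
            real n powr (1/3) * (\<bar>a_hat n \<omega> - crossing P\<bar> + \<bar>a_hat n \<omega> - crossing Q\<bar>)"
          by (intro mult_left_mono) auto
        moreover have "real n powr (1/3) * (\<kappa> * w n) < real n powr (1/3) * \<bar>crossing P - crossing Q\<bar>"
          using \<rho>(5) n by (intro mult_strict_left_mono) auto
        moreover have "real n powr (1/3) * (\<kappa> * w n) = \<kappa> * D * (L + 1) powr (1/3)"
          using n L by (simp add: w_def powr_divide)
        moreover have "\<kappa> * D * L powr (1/3) \<le> \<kappa> * D * (L + 1) powr (1/3)"
          using L pos D by (intro mult_left_mono powr_mono2) auto
        ultimately show False by (simp add: T_def c1_def)
      qed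
      have "2 * \<delta> * (2 - 2 * \<delta>) \<le> exp (- (L + 1) / 12)"
        unfolding L_def by (rule exp_ge_testing_level[OF \<delta>])
      also have "\<dots> \<le> exp (- 2 * (C * w n ^ 3)) ^ (2 * n)"
        using n L D(2) pos by (simp add: exp_of_nat_mult[symmetric] w3)
      also have "\<dots> \<le> (1 - C * w n ^ 3) ^ (2 * n)"
        using Cw by (intro power_mono exp_le_one_minus) auto
      also have "\<dots> \<le> (\<integral>v. sqrt (\<rho> v) \<partial>P) ^ (2 * card {..<n})"
        using \<rho>(4) Cw by (simp only: card_lessThan) (intro power_mono, auto)
      finally have B: "2 * \<delta> * (2 - 2 * \<delta>) \<le> (\<integral>v. sqrt (\<rho> v) \<partial>P) ^ (2 * card {..<n})" .
      have "prob_space P" "prob_space (density P (\<lambda>v. ennreal (\<rho> v)))"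
        using P Q U_tilde \<rho>(3) by (auto simp: calP_tilde_def)
      \<comment> \<open>The level is \<open>2 * \<delta>\<close> because it bounds the sum of two
        failure probabilities, each of which is at most the supremum over \<open>U\<close>.\<close>
      from two_point_lower_bound[OF this \<rho>(1,2) _ _ _ B, of "E n P" "E n Q"]
      have "ennreal (2 * \<delta>) \<le> emeasure (\<Pi>\<^sub>M i\<in>{..<n}. P) (E n P) + emeasure (\<Pi>\<^sub>M i\<in>{..<n}. Q) (E n Q)"
        using \<delta> E_sets[OF P] E_sets[OF Q, of n, unfolded sets_eq] cover by (simp add: \<rho>(3)[symmetric])
      also have "\<dots> \<le> (SUP P\<in>U. emeasure (\<Pi>\<^sub>M i\<in>{..<n}. P) (E n P)) +
          (SUP P\<in>U. emeasure (\<Pi>\<^sub>M i\<in>{..<n}. P) (E n P))"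
        using P Q by (intro add_mono SUP_upper)
      also have "\<dots> = 2 * (SUP P\<in>U. emeasure (\<Pi>\<^sub>M i\<in>{..<n}. P) (E n P))"
        by (rule mult_2[symmetric])
      also have "ennreal (2 * \<delta>) = 2 * ennreal \<delta>"
        using \<delta> by (subst ennreal_mult) auto
      finally show ?case
        by (rule ennreal_mult_le_mult_iff[THEN iffD1, rotated 2]) auto
    qed
    then have "ennreal \<delta> \<le> liminf (\<lambda>n. SUP P\<in>U. emeasure (\<Pi>\<^sub>M i\<in>{..<n}. P) (E n P))"
      by (rule Liminf_bounded)
    then show ?case unfolding E_def T_def L_def .
  qed
qed

end
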